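(* Let $S$ be a set of non-Archimedean places of $\mathbb{Q}$, $X$ the set of places of $\overline{\mathbb{Q}}$ dividing a place in $S$, and let $c:\mathcal J\to\mathbb{R}$ be a consistent map. Let $\mathcal F=\{f_\alpha:\alpha\in\overline{\mathbb{Q}}^\times\}$, where $f_\alpha:X\to\mathbb{R}$, $f_\alpha(x)=\log\|\alpha\|_x$. Then $\Phi_c(\mathcal F)\subseteq\mathbb{Q}$ if and only if $c(K,v)\log p_v\in\mathbb{Q}$ for all $(K,v)\in\mathcal J$.
   Context: Fix an algebraic closure $\overline{\mathbb{Q}}$; number fields lie inside it. For a place $v$ of a number field $K$, $p_v$ denotes the place of $\mathbb{Q}$ (here a prime) below $v$. $Y$ is the set of all places of $\overline{\mathbb{Q}}$, $Y(K,v)=\{y\in Y:y\mid v\}$, with topology having basis $\{Y(K,v)\}$. For $y\in Y$ dividing the prime $p$, $\|\cdot\|_y$ is the absolute value on $\overline{\mathbb{Q}}$ associated with $y$ extending the usual $p$-adic absolute value on $\mathbb{Q}$ (so $\|p\|_y=p^{-1}$); for $v$ a place of $K$, $\|\cdot\|_v$ is the corresponding absolute value on $K$ extending the $p_v$-adic one. $M_K(S)$ is the set of places of $K$ dividing a place of $S$, and $\mathcal J=\{(K,v): K \text{ a number field},\ v\in M_K(S)\}$. A map $c:\mathcal J\to\mathbb{R}$ is consistent if $c(K,v)=\sum_{w\mid v}c(L,w)$ for all $(K,v)\in\mathcal J$ and all finite extensions $L/K$. Each $f_\alpha$ is a locally constant, compactly supported function on $X$. For $f$ locally constant with compact support on $X$,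 there is a number field $K$ with $f$ constant on each $Y(K,v)$, $v\in M_K(S)$, with value $f(v)$ zero for all but finitely many $v$, and $\Phi_c(f)=\sum_{v\in M_K(S)}c(K,v)f(v)$, independent of such $K$. *)

theory Defs
  imports Complex_Main "HOL-Computational_Algebra.Primes"
begin

text \<open>The algebraic closure of Q is realised as the algebraic complex numbers;
number fields are finite-dimensional subfields of the complex numbers.\<close>

definition number_field :: "complex set \<Rightarrow> bool" where
  "number_field K \<longleftrightarrow>
     0 \<in> K \<and> 1 \<in> K \<and>
     (\<forall>x\<in>K. \<forall>y\<in>K. x + y \<in> K \<and> x - y \<in> K \<and> x * y \<in> K) \<and>
     (\<forall>x\<in>K. inverse x \<in> K) \<and>
     (\<exists>B. finite B \<and> B \<subseteq> K \<and>
        K = {z. \<exists>q::complex \<Rightarrow> rat. z = (\<Sum>b\<in>B. of_rat (q b) * b)})"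

definition Qbar :: "complex set" where
  "Qbar = {z. \<exists>K. number_field K \<and> z \<in> K}"

definition padic_abs :: "nat \<Rightarrow> rat \<Rightarrow> real" where
  "padic_abs p r = (if r = 0 then 0 else
     real p powr (- (real_of_int (int (multiplicity (int p) (fst (quotient_of r))))
                     - real_of_int (int (multiplicity (int p) (snd (quotient_of r)))))))"

text \<open>A place of the field F (a subfield of C) above the prime p, represented by its
absolute value extending the p-adic one (set to 0 outside F for extensionality).\<close>
definition place_over :: "complex set \<Rightarrow> nat \<Rightarrow> (complex \<Rightarrow> real) \<Rightarrow> bool" where
  "place_over F p v \<longleftrightarrow>
     (\<forall>x. x \<notin> F \<longrightarrow> v x = 0) \<and>
     (\<forall>x\<in>F. v x \<ge> 0 \<and> (v x = 0 \<longleftrightarrow> x = 0)) \<and>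
     (\<forall>x\<in>F. \<forall>y\<in>F. v (x * y) = v x * v y \<and> v (x + y) \<le> v x + v y) \<and>
     (\<forall>r. v (of_rat r) = padic_abs p r)"

definition places_S :: "nat set \<Rightarrow> complex set \<Rightarrow> (complex \<Rightarrow> real) set" where
  "places_S S K = {v. \<exists>p\<in>S. place_over K p v}"

definition prime_below :: "nat set \<Rightarrow> complex set \<Rightarrow> (complex \<Rightarrow> real) \<Rightarrow> nat" where
  "prime_below S K v = (THE p. p \<in> S \<and> place_over K p v)"

definition divides_place :: "complex set \<Rightarrow> (complex \<Rightarrow> real) \<Rightarrow> (complex \<Rightarrow> real) \<Rightarrow> bool" where
  "divides_place K w v \<longleftrightarrow> (\<forall>x\<in>K. w x = v x)"

definition J_set :: "nat set \<Rightarrow> (complex set \<times> (complex \<Rightarrow> real)) set" where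
  "J_set S = {(K, v). number_field K \<and> v \<in> places_S S K}"

definition consistent :: "nat set \<Rightarrow> (complex set \<Rightarrow> (complex \<Rightarrow> real) \<Rightarrow> real) \<Rightarrow> bool" where
  "consistent S c \<longleftrightarrow>
     (\<forall>(K, v) \<in> J_set S. \<forall>L. number_field L \<and> K \<subseteq> L \<longrightarrow>
        c K v = (\<Sum>w \<in> {w \<in> places_S S L. divides_place K w v}. c L w))"

definition X_places :: "nat set \<Rightarrow> (complex \<Rightarrow> real) set" where
  "X_places S = places_S S Qbar"

definition Phi :: "nat set \<Rightarrow> (complex set \<Rightarrow> (complex \<Rightarrow> real) \<Rightarrow> real)
                     \<Rightarrow> ((complex \<Rightarrow> real) \<Rightarrow> real) \<Rightarrow> real" where
  "Phi S c f = (SOME r. \<exists>K g. number_field K \<and>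
       (\<forall>v \<in> places_S S K. \<forall>y \<in> X_places S. divides_place K y v \<longrightarrow> f y = g v) \<and>
       finite {v \<in> places_S S K. g v \<noteq> 0} \<and>
       r = (\<Sum>v \<in> {v \<in> places_S S K. g v \<noteq> 0}. c K v * g v))"

definition f_alpha :: "complex \<Rightarrow> (complex \<Rightarrow> real) \<Rightarrow> real" where
  "f_alpha \<alpha> x = ln (x \<alpha>)"

end

theory Submission
  imports Defs "HOL-Computational_Algebra.Polynomial" "Jordan_Normal_Form.Determinant"
begin

text \<open>A place of a number field \<open>K\<close> extends to the algebraic closure (Chevalley's argument) and there are
only finitely many places of \<open>K\<close> above a prime, so by consistency \<open>\<Phi>\<^sub>c(f)\<close> may be
computed over any number field on which \<open>f\<close> is constant. Since every nonzero \<open>\<alpha>\<close> in \<open>K\<close> has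
\<open>\<parallel>\<alpha>\<parallel>\<^sub>v = p\<^sub>v\<^sup>r\<close> with \<open>r\<close> rational, the sum
\<open>\<Phi>\<^sub>c(f\<^sub>\<alpha>)\<close> is a rational combination of the numbers \<open>c(K,v) log p\<^sub>v\<close>. Conversely,
because the ideal class group is torsion, for every \<open>(K,v)\<close> some \<open>\<alpha>\<close> in \<open>K\<close> is nontrivial at \<open>v\<close> and
trivial at all other places, which isolates \<open>c(K,v) log p\<^sub>v\<close>. Torsion is obtained without ideal
theory, from Hurwitz's pigeonhole form of the norm-Euclidean property.\<close>

section \<open>Number fields\<close>

text \<open>\<open>Phi\<close> is a choice over all pairs (K, g), and g is tied to f at a place v
  only through the places of \<open>Qbar\<close> above v. If some v had none, g v would be
  arbitrary, so consistency of c alone cannot make the value well defined; this is why the extension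
  of places is needed. Places are normalised by |p| = 1/p, so values on K are rational rather than
  integral powers of p. A valuation ring is handled through its units: an algebraic x has some x^d
  p^k among them, and this one fact gives both the absolute value on \<open>Qbar\<close> and the
  rational exponents. The converse needs an element that is nontrivial at exactly one place.
  Approximation controls finitely many places and leaves stray values at the others. Control at all
  places must come from a global finiteness: one fixed integer B carries every ideal of a suitable
  sequence into a principal one. Values off v then come from a finite set of patterns, while the
  values at v tend to 0.\<close>

interpretation Q: vector_space "\<lambda>(q::rat) (z::complex). of_rat q * z"
  by unfold_locales (simp_all add: algebra_simps of_rat_add of_rat_mult)

definition complex_subfield :: "complex set \<Rightarrow> bool" where
  "complex_subfield F \<longleftrightarrow> 0 \<in> F \<and> 1 \<in> F \<and>
     (\<forall>x\<in>F. \<forall>y\<in>F. x + y \<in> F \<and> x - y \<in> F \<and> x * y \<in> F) \<and> (\<forall>x\<in>F. inverse x \<in> F)"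

lemma number_field_iff:
  "number_field K \<longleftrightarrow> complex_subfield K \<and> (\<exists>B. finite B \<and> K = Q.span B)"
proof -
  have "(finite B \<and> B \<subseteq> K \<and> K = {z. \<exists>q::complex \<Rightarrow> rat. z = (\<Sum>b\<in>B. of_rat (q b) * b)}) \<longleftrightarrow>
        (finite B \<and> K = Q.span B)" for B
  proof (cases "finite B")
    case True
    then have "{z. \<exists>q::complex \<Rightarrow> rat. z = (\<Sum>b\<in>B. of_rat (q b) * b)} = Q.span B"
      by (auto simp: Q.span_finite)
    then show ?thesis using Q.span_superset[of B] by metis
  qed simp
  note * = iff_exI[OF this]
  show ?thesis
    unfolding number_field_def complex_subfield_def * by (simp only: conj_assoc)
qed

context
  fixes F assumes F: "complex_subfield F"
begin

lemma sf_0: "0 \<in> F" and sf_1: "1 \<in> F"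
  and sf_add: "x \<in> F \<Longrightarrow> y \<in> F \<Longrightarrow> x + y \<in> F"
  and sf_diff: "x \<in> F \<Longrightarrow> y \<in> F \<Longrightarrow> x - y \<in> F"
  and sf_mult: "x \<in> F \<Longrightarrow> y \<in> F \<Longrightarrow> x * y \<in> F"
  and sf_inverse: "x \<in> F \<Longrightarrow> inverse x \<in> F"
  using F by (auto simp: complex_subfield_def)

lemma sf_uminus: "x \<in> F \<Longrightarrow> - x \<in> F"
  using sf_diff[OF sf_0, of x] by simp

lemma sf_divide: "x \<in> F \<Longrightarrow> y \<in> F \<Longrightarrow> x / y \<in> F"
  by (simp add: divide_inverse sf_mult sf_inverse)

lemma sf_power: "x \<in> F \<Longrightarrow> x ^ k \<in> F"
  by (induction k) (auto simp: sf_1 sf_mult)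

lemma sf_power_int: "x \<in> F \<Longrightarrow> x powi k \<in> F"
  by (auto simp: power_int_def sf_power sf_inverse)

lemma sf_sum: "(\<And>i. i \<in> I \<Longrightarrow> f i \<in> F) \<Longrightarrow> sum f I \<in> F"
  by (induction I rule: infinite_finite_induct) (auto simp: sf_0 sf_add)

lemma sf_of_nat: "of_nat n \<in> F"
  by (induction n) (auto simp: sf_0 sf_1 sf_add)

lemma sf_of_int: "of_int n \<in> F"
  by (cases n rule: int_cases2) (auto simp: sf_of_nat sf_uminus)

lemma sf_of_rat: "of_rat q \<in> F"
proof -
  obtain a b where "q = Rat.Fract a b" "b > 0" by (cases q)
  then show ?thesis by (simp add: of_rat_rat sf_divide sf_of_int)
qed

end

lemma number_field_subfield: "number_field K \<Longrightarrow> complex_subfield K"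
  by (simp add: number_field_iff)

lemma common_denominator:
  fixes q :: "'a \<Rightarrow> rat"
  assumes "finite I"
  shows "\<exists>D::int. D > 0 \<and> (\<forall>i\<in>I. of_int D * q i \<in> \<int>)"
  using assms
proof induction
  case empty
  show ?case by (intro exI[of _ 1]) auto
next
  case (insert j I)
  then obtain D :: int where D: "D > 0" "\<forall>i\<in>I. of_int D * q i \<in> \<int>" by auto
  obtain a b where ab: "q j = Rat.Fract a b" "b > 0" by (cases "q j")
  have "of_int (D * b) * q i \<in> \<int>" if "i \<in> insert j I" for i
  proof (cases "i = j")
    case True
    have "of_int (D * b) * q j = of_int (D * a)"
      using ab by (simp add: Fract_of_int_quotient)
    then show ?thesis unfolding True by (metis Ints_of_int)
  next
    case False
    then have "of_int D * q i \<in> \<int>" using that D by auto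
    then have "of_int b * (of_int D * q i) \<in> \<int>" by (rule Ints_mult[OF Ints_of_int])
    moreover have "of_int b * (of_int D * q i) = of_int (D * b) * q i" by (simp add: ac_simps)
    ultimately show ?thesis by metis
  qed
  then show ?case using D ab by (intro exI[of _ "D * b"]) auto
qed

lemma Ints_rat_of_int: "(q::rat) \<in> \<int> \<Longrightarrow> of_int \<lfloor>q\<rfloor> = q"
  by (auto elim: Ints_cases)

text \<open>Clearing denominators and dividing by the gcd makes the relation primitive at every
  prime at once. \<open>separating_integer\<close> uses this: a coefficient prime to p has value 1
  at every place above p.\<close>

lemma primitive_relation:
  assumes "\<exists>i\<le>N. q i \<noteq> (0::rat)" and "(\<Sum>i\<le>N. of_rat (q i) * x ^ i) = (0::complex)"
  shows "\<exists>a::nat \<Rightarrow> int. (\<Sum>i\<le>N. of_int (a i) * x ^ i) = 0 \<and> (\<exists>i\<le>N. a i \<noteq> 0) \<and>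
           (\<forall>p. prime p \<longrightarrow> (\<exists>i\<le>N. \<not> int p dvd a i))"
proof -
  obtain D :: int where D: "D > 0" "\<forall>i\<in>{..N}. of_int D * q i \<in> \<int>"
    using common_denominator[of "{..N}" q] by auto
  define e where "e i = \<lfloor>of_int D * q i\<rfloor>" for i
  have e: "of_int (e i) = of_int D * q i" if "i \<le> N" for i
    using D that Ints_rat_of_int unfolding e_def by auto
  have e': "(of_int (e i) :: complex) = of_int D * of_rat (q i)" if "i \<le> N" for i
    using arg_cong[OF e[OF that], of "of_rat :: rat \<Rightarrow> complex"] by (simp add: of_rat_mult)
  have e_sum: "(\<Sum>i\<le>N. of_int (e i) * x ^ i) = 0"
  proof -
    have "(\<Sum>i\<le>N. of_int (e i) * x ^ i) = of_int D * (\<Sum>i\<le>N. of_rat (q i) * x ^ i)"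
      unfolding sum_distrib_left by (intro sum.cong) (auto simp: e')
    then show ?thesis using assms(2) by simp
  qed
  obtain i0 where i0: "i0 \<le> N" "q i0 \<noteq> 0" using assms(1) by auto
  have ei0: "e i0 \<noteq> 0" using e[OF i0(1)] i0 D by auto
  define g where "g = Gcd (e ` {..N})"
  have g0: "g \<noteq> 0" using ei0 i0 by (auto simp: g_def)
  have gdvd: "g dvd e i" if "i \<le> N" for i using that by (auto simp: g_def)
  define a where "a i = e i div g" for i
  have ea: "e i = g * a i" if "i \<le> N" for i using gdvd[OF that] by (simp add: a_def)
  have "(\<Sum>i\<le>N. of_int (e i) * x ^ i) = of_int g * (\<Sum>i\<le>N. of_int (a i) * x ^ i)"
    unfolding sum_distrib_left by (intro sum.cong) (auto simp: ea)
  then have 1: "(\<Sum>i\<le>N. of_int (a i) * x ^ i) = 0" using e_sum g0 by simp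
  have 2: "\<exists>i\<le>N. a i \<noteq> 0" using ei0 i0 ea by force
  have 3: "\<exists>i\<le>N. \<not> int p dvd a i" if "prime p" for p
  proof (rule ccontr)
    assume "\<not> (\<exists>i\<le>N. \<not> int p dvd a i)"
    then have "g * int p dvd e i" if "i \<le> N" for i using that by (auto simp: ea)
    then have "g * int p dvd g" unfolding g_def by (intro Gcd_greatest) auto
    then have "int p dvd 1" using g0 by simp
    then show False using that by auto
  qed
  show ?thesis using 1 2 3 by blast
qed

lemma finite_span_relation:
  assumes fin: "finite B" and sub: "\<And>i. x ^ i \<in> Q.span B"
  shows "\<exists>q. (\<exists>i\<le>card B. q i \<noteq> (0::rat)) \<and> (\<Sum>i\<le>card B. of_rat (q i) * x ^ i) = (0::complex)"
\<comment> \<open>Dependence is a property of sets, so equal powers of x would be counted once. Two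
  equal powers are treated apart, as they already give a relation.\<close>
proof (cases "inj_on (\<lambda>i. x ^ i) {..card B}")
  case False
  then obtain i j where ij: "i \<le> card B" "j \<le> card B" "i \<noteq> j" "x ^ i = x ^ j"
    by (auto simp: inj_on_def)
  let ?q = "\<lambda>k. if k = i then 1 else if k = j then - 1 else (0::rat)"
  have "(\<Sum>k\<le>card B. of_rat (?q k) * x ^ k) = (\<Sum>k\<in>{i,j}. of_rat (?q k) * x ^ k)"
    using ij by (intro sum.mono_neutral_right) auto
  also have "\<dots> = 0" using ij by simp
  finally show ?thesis using ij by (intro exI[of _ ?q]) auto
next
  case True
  let ?P = "(\<lambda>i. x ^ i) ` {..card B}"
  have "card ?P = Suc (card B)" using True by (simp add: card_image)
  then have "Q.dependent ?P"
    using Q.independent_span_bound[OF fin, of ?P] sub by fastforce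
  then obtain u where u: "(\<exists>v\<in>?P. u v \<noteq> 0)" "(\<Sum>v\<in>?P. of_rat (u v) * v) = 0"
    by (subst (asm) Q.dependent_finite) auto
  have "(\<Sum>i\<le>card B. of_rat (u (x ^ i)) * x ^ i) = 0"
    using u(2) by (simp add: sum.reindex[OF True])
  then show ?thesis using u(1) by (intro exI[of _ "\<lambda>i. u (x ^ i)"]) auto
qed

text \<open>One degree bound N serves all x in K. The exponents of all values then share the
  denominator N!, which leaves only finitely many candidates in
  \<open>single_place_element\<close>.\<close>

lemma number_field_primitive_relation:
  assumes "number_field K"
  shows "\<exists>N. \<forall>x\<in>K. \<exists>a::nat \<Rightarrow> int. (\<Sum>i\<le>N. of_int (a i) * x ^ i) = 0 \<and> (\<exists>i\<le>N. a i \<noteq> 0) \<and>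
           (\<forall>p. prime p \<longrightarrow> (\<exists>i\<le>N. \<not> int p dvd a i))"
proof -
  obtain B where B: "finite B" "K = Q.span B" using assms by (auto simp: number_field_iff)
  show ?thesis
  proof (intro exI[of _ "card B"] ballI)
    fix x assume "x \<in> K"
    then have "x ^ i \<in> Q.span B" for i
      using sf_power[OF number_field_subfield[OF assms]] B by auto
    from finite_span_relation[OF B(1) this] obtain q where
      "\<exists>i\<le>card B. q i \<noteq> 0" "(\<Sum>i\<le>card B. of_rat (q i) * x ^ i) = 0" by blast
    then show "\<exists>a::nat \<Rightarrow> int. (\<Sum>i\<le>card B. of_int (a i) * x ^ i) = 0 \<and> (\<exists>i\<le>card B. a i \<noteq> 0) \<and>
           (\<forall>p. prime p \<longrightarrow> (\<exists>i\<le>card B. \<not> int p dvd a i))"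
      by (rule primitive_relation)
  qed
qed

text \<open>Dividing a relation among the powers of x by its lowest occurring power leaves a nonzero
  constant term, and solving for that term shows 1/x to be a polynomial in x.\<close>

lemma finite_span_inverse:
  assumes fin: "finite B" and one: "1 \<in> Q.span B"
    and mult: "\<And>x y. x \<in> Q.span B \<Longrightarrow> y \<in> Q.span B \<Longrightarrow> x * y \<in> Q.span B"
    and x: "x \<in> Q.span B"
  shows "inverse x \<in> Q.span B"
proof (cases "x = 0")
  case False
  have pow: "x ^ i \<in> Q.span B" for i by (induction i) (auto simp: one mult x)
  obtain q where q: "\<exists>i\<le>card B. q i \<noteq> 0" "(\<Sum>i\<le>card B. of_rat (q i) * x ^ i) = 0"
    using finite_span_relation[OF fin pow] by blast
  define m where "m = (LEAST i. i \<le> card B \<and> q i \<noteq> 0)"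
  have m: "m \<le> card B" "q m \<noteq> 0" using LeastI_ex[OF q(1)] by (auto simp: m_def)
  have small: "q i = 0" if "i < m" for i
    using not_less_Least[of i "\<lambda>i. i \<le> card B \<and> q i \<noteq> 0"] that m by (auto simp: m_def)
  have "(\<Sum>i\<le>card B. of_rat (q i) * x ^ i) = (\<Sum>i\<in>{m..card B}. of_rat (q i) * x ^ i)"
    by (intro sum.mono_neutral_right) (auto simp: small)
  also have "{m..card B} = insert m {m<..card B}" using m by auto
  also have "(\<Sum>i\<in>\<dots>. of_rat (q i) * x ^ i) = of_rat (q m) * x ^ m + (\<Sum>i\<in>{m<..card B}. of_rat (q i) * x ^ i)"
    by simp
  also have "(\<Sum>i\<in>{m<..card B}. of_rat (q i) * x ^ i) = x ^ Suc m * (\<Sum>i\<in>{m<..card B}. of_rat (q i) * x ^ (i - Suc m))"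
    unfolding sum_distrib_left
    by (intro sum.cong) (auto simp: power_add[symmetric] simp flip: power_Suc)
  finally have "x ^ m * (of_rat (q m) + x * (\<Sum>i\<in>{m<..card B}. of_rat (q i) * x ^ (i - Suc m))) = 0"
    using q(2) by (simp add: algebra_simps)
  then have *: "of_rat (q m) + x * (\<Sum>i\<in>{m<..card B}. of_rat (q i) * x ^ (i - Suc m)) = 0" (is "_ + x * ?s = 0")
    using False by simp
  have "?s \<in> Q.span B" by (intro Q.span_sum Q.span_scale pow)
  then have "of_rat (- 1 / q m) * ?s \<in> Q.span B" by (rule Q.span_scale)
  moreover have "x * (of_rat (- 1 / q m) * ?s) = 1"
  proof -
    have "x * ?s = - of_rat (q m)" using * by (simp add: add_eq_0_iff)
    then have "x * (of_rat (- 1 / q m) * ?s) = of_rat (- 1 / q m) * (- of_rat (q m))"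
      by (simp only: mult.left_commute[of x])
    also have "\<dots> = of_rat (- 1 / q m * (- q m))" by (simp only: of_rat_mult of_rat_minus)
    also have "\<dots> = 1" using m by simp
    finally show ?thesis .
  qed
  ultimately show ?thesis by (metis inverse_unique)
qed (simp add: Q.span_zero)

text \<open>The products of two spanning sets span a ring of finite dimension over the rationals,
  and \<open>finite_span_inverse\<close> makes it a field.\<close>

lemma number_field_compositum:
  assumes K: "number_field K" and L: "number_field L"
  shows "\<exists>M. number_field M \<and> K \<subseteq> M \<and> L \<subseteq> M"
proof -
  obtain B where B: "finite B" "K = Q.span B" using K by (auto simp: number_field_iff)
  obtain C where C: "finite C" "L = Q.span C" using L by (auto simp: number_field_iff)
  note sK = number_field_subfield[OF K] and sL = number_field_subfield[OF L]
  define P where "P = (\<lambda>(b, c). b * c) ` (B \<times> C)"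
  have fP: "finite P" using B C by (simp add: P_def)
  have prod: "x * y \<in> Q.span P" if "x \<in> K" "y \<in> L" for x y
  proof -
    from that(1) have "x \<in> Q.span B" using B by simp
    then obtain r where r: "x = (\<Sum>b\<in>B. of_rat (r b) * b)" using Q.span_finite[OF B(1)] by auto
    from that(2) have "y \<in> Q.span C" using C by simp
    then obtain s where s: "y = (\<Sum>b\<in>C. of_rat (s b) * b)" using Q.span_finite[OF C(1)] by auto
    have "x * y = (\<Sum>b\<in>B. \<Sum>c\<in>C. of_rat (r b * s c) * (b * c))"
      unfolding r s sum_product by (intro sum.cong refl) (simp add: of_rat_mult mult_ac)
    also have "\<dots> \<in> Q.span P"
      by (intro Q.span_sum Q.span_scale Q.span_base) (auto simp: P_def)
    finally show ?thesis .
  qed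
  have mult: "x * y \<in> Q.span P" if x: "x \<in> Q.span P" and y: "y \<in> Q.span P" for x y
  proof -
    obtain r where r: "x = (\<Sum>b\<in>P. of_rat (r b) * b)" using x Q.span_finite[OF fP] by auto
    obtain s where s: "y = (\<Sum>b\<in>P. of_rat (s b) * b)" using y Q.span_finite[OF fP] by auto
    have PP: "b * c \<in> Q.span P" if "b \<in> P" "c \<in> P" for b c
    proof -
      obtain b1 b2 c1 c2 where *: "b = b1 * b2" "c = c1 * c2" "b1 \<in> B" "b2 \<in> C" "c1 \<in> B" "c2 \<in> C"
        using \<open>b \<in> P\<close> \<open>c \<in> P\<close> by (auto simp: P_def)
      have "(b1 * c1) * (b2 * c2) \<in> Q.span P"
        using * B C Q.span_superset by (intro prod sf_mult[OF sK] sf_mult[OF sL]) auto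
      then show ?thesis using * by (simp add: mult_ac)
    qed
    have "x * y = (\<Sum>b\<in>P. \<Sum>c\<in>P. of_rat (r b * s c) * (b * c))"
      unfolding r s sum_product by (intro sum.cong refl) (simp add: of_rat_mult mult_ac)
    also have "\<dots> \<in> Q.span P" by (intro Q.span_sum Q.span_scale PP)
    finally show ?thesis .
  qed
  have KP: "K \<subseteq> Q.span P" using prod[OF _ sf_1[OF sL]] by auto
  have LP: "L \<subseteq> Q.span P" using prod[OF sf_1[OF sK]] by auto
  have one: "1 \<in> Q.span P" using KP sf_1[OF sK] by auto
  have "number_field (Q.span P)"
    unfolding number_field_iff complex_subfield_def
    using fP one mult finite_span_inverse[OF fP one mult]
    by (auto simp: Q.span_zero Q.span_add Q.span_diff)
  then show ?thesis using KP LP by blast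
qed

lemma number_field_Rats: "number_field (range of_rat)"
proof -
  have "range of_rat = Q.span {1}" by (simp add: Q.span_singleton)
  moreover have "complex_subfield (range of_rat)"
    unfolding complex_subfield_def Rats_def[symmetric] by auto
  ultimately show ?thesis unfolding number_field_iff by blast
qed

lemma number_field_subset_Qbar: "number_field K \<Longrightarrow> K \<subseteq> Qbar"
  by (auto simp: Qbar_def)

lemma Qbar_subfield: "complex_subfield Qbar"
proof -
  have two: "\<exists>M. number_field M \<and> x \<in> M \<and> y \<in> M" if "x \<in> Qbar" "y \<in> Qbar" for x y
  proof -
    obtain K L where "number_field K" "x \<in> K" "number_field L" "y \<in> L"
      using \<open>x \<in> Qbar\<close> \<open>y \<in> Qbar\<close> by (auto simp: Qbar_def)
    then show ?thesis using number_field_compositum[of K L] by blast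
  qed
  show ?thesis
    unfolding complex_subfield_def
  proof (intro conjI ballI)
    show "0 \<in> Qbar" "1 \<in> Qbar"
      using number_field_subset_Qbar[OF number_field_Rats]
        sf_0[OF number_field_subfield[OF number_field_Rats]]
        sf_1[OF number_field_subfield[OF number_field_Rats]] by auto
    show "inverse x \<in> Qbar" if "x \<in> Qbar" for x
      using two[OF that that] sf_inverse number_field_subfield number_field_subset_Qbar by blast
    fix x y assume xy: "x \<in> Qbar" "y \<in> Qbar"
    then obtain M where M: "number_field M" "x \<in> M" "y \<in> M" using two by blast
    note s = number_field_subfield[OF M(1)]
    show "x + y \<in> Qbar" "x - y \<in> Qbar" "x * y \<in> Qbar"
      using number_field_subset_Qbar[OF M(1)] sf_add[OF s] sf_diff[OF s] sf_mult[OF s] M(2,3) by auto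
  qed
qed

section \<open>Places\<close>

lemma padic_abs_of_int:
  "padic_abs p (of_int m) = (if m = 0 then 0 else real p powr (- real (multiplicity (int p) m)))"
  by (simp add: padic_abs_def)

text \<open>Bernoulli's inequality is itself only linear; squaring it gives quadratic growth of
  r^(2n), enough to contradict a linear bound.\<close>

lemma exponential_le_linear:
  fixes r :: real
  assumes "\<And>n. r ^ n \<le> real n + 1"
  shows "r \<le> 1"
proof (rule ccontr)
  assume "\<not> r \<le> 1"
  define d where "d = r - 1"
  have d: "d > 0" "r = 1 + d" using \<open>\<not> r \<le> 1\<close> by (auto simp: d_def)
  \<comment> \<open>The chain below ends in n^2 d^2 \<le> 2n + 1 \<le> 3n, which fails once n d^2 >
    3.\<close>
  obtain n where n: "real n > 3 / d\<^sup>2" using reals_Archimedean2 by blast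
  have "3 / d\<^sup>2 > 0" using d by simp
  then have n0: "real n > 0" using n by linarith
  have "(real n * d)\<^sup>2 \<le> (1 + real n * d)\<^sup>2" using d by (intro power_mono) auto
  also have "\<dots> \<le> ((1 + d) ^ n)\<^sup>2" using d Bernoulli_inequality[of d n] by (intro power_mono) auto
  also have "\<dots> = r ^ (2 * n)" using d by (simp add: power_mult mult.commute[of 2 n])
  also have "\<dots> \<le> 2 * real n + 1" using assms[of "2 * n"] by simp
  also have "\<dots> \<le> 3 * real n" using n0 by (cases n) auto
  finally have "real n * (real n * d\<^sup>2) \<le> real n * 3" by (simp add: power2_eq_square mult_ac)
  then have "real n * d\<^sup>2 \<le> 3" using n0 by (simp only: mult_le_cancel_left_pos)
  then show False using n d by (simp add: field_simps)
qed

locale place =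
  fixes F p v
  assumes subfield: "complex_subfield F" and prime: "prime p" and place: "place_over F p v"
begin

lemma p_gt_1: "real p > 1"
  using prime prime_gt_1_nat by simp

lemma out: "x \<notin> F \<Longrightarrow> v x = 0"
  using place by (simp add: place_over_def)

lemma nonneg [simp]: "v x \<ge> 0"
  using place by (cases "x \<in> F") (auto simp: place_over_def)

lemma eq_0_iff: "x \<in> F \<Longrightarrow> v x = 0 \<longleftrightarrow> x = 0"
  using place by (auto simp: place_over_def)

lemma zero [simp]: "v 0 = 0"
  using eq_0_iff sf_0[OF subfield] by auto

lemma pos: "x \<in> F \<Longrightarrow> x \<noteq> 0 \<Longrightarrow> v x > 0"
  using eq_0_iff[of x] nonneg[of x] by linarith

lemma mult: "x \<in> F \<Longrightarrow> y \<in> F \<Longrightarrow> v (x * y) = v x * v y"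
  and triangle: "x \<in> F \<Longrightarrow> y \<in> F \<Longrightarrow> v (x + y) \<le> v x + v y"
  and of_rat: "v (of_rat r) = padic_abs p r"
  using place by (auto simp: place_over_def)

lemma one [simp]: "v 1 = 1"
  using of_rat[of 1] p_gt_1 by (simp add: padic_abs_def)

lemma of_int: "v (of_int m) = (if m = 0 then 0 else real p powr (- real (multiplicity (int p) m)))"
  using of_rat[of "of_int m"] unfolding padic_abs_of_int by simp

lemma of_int_le_1: "v (of_int m) \<le> 1"
  using powr_mono[of "- real (multiplicity (int p) m)" 0 "real p"] p_gt_1 by (auto simp: of_int)

lemma of_nat_le_1: "v (of_nat m) \<le> 1"
  using of_int_le_1[of "int m"] by simp

lemma of_int_eq_1: "\<not> int p dvd m \<Longrightarrow> v (of_int m) = 1"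
  using p_gt_1 by (auto simp: of_int not_dvd_imp_multiplicity_0)

lemma of_nat_p: "v (of_nat p) = 1 / real p"
proof -
  have "multiplicity (int p) (int p) = 1"
    using prime by (simp add: multiplicity_self prime_gt_1_nat)
  then show ?thesis using of_int[of "int p"] p_gt_1 by (simp add: powr_minus_divide)
qed

lemma minus: "v (- x) = v x"
proof (cases "x \<in> F")
  case True
  have "v (- 1) = 1"
    using of_int_eq_1[of "- 1"] prime_gt_1_nat[OF prime] by auto
  then show ?thesis using mult[OF sf_uminus[OF subfield sf_1[OF subfield]] True] by simp
next
  case False
  then have "- x \<notin> F" using sf_uminus[OF subfield, of "- x"] by auto
  then show ?thesis using False by (simp add: out)
qed

lemma inverse: "x \<in> F \<Longrightarrow> v (inverse x) = inverse (v x)"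
proof (cases "x = 0")
  case False
  assume x: "x \<in> F"
  have "v x * v (inverse x) = 1"
    using mult[OF x sf_inverse[OF subfield x]] False by simp
  then show ?thesis by (simp add: inverse_unique)
qed simp

lemma divide: "x \<in> F \<Longrightarrow> y \<in> F \<Longrightarrow> v (x / y) = v x / v y"
  by (simp add: divide_inverse mult inverse sf_inverse[OF subfield])

lemma power: "x \<in> F \<Longrightarrow> v (x ^ k) = v x ^ k"
  by (induction k) (auto simp: mult sf_power[OF subfield])

lemma power_int: "x \<in> F \<Longrightarrow> v (x powi k) = v x powi k"
  by (auto simp: power_int_def power inverse sf_inverse[OF subfield])

lemma p_in: "of_nat p \<in> F"
  by (rule sf_of_nat[OF subfield])

lemma sum_le: "(\<And>i. i \<in> I \<Longrightarrow> f i \<in> F) \<Longrightarrow> v (sum f I) \<le> (\<Sum>i\<in>I. v (f i))"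
proof (induction I rule: infinite_finite_induct)
  case (insert i I)
  then have "v (f i + sum f I) \<le> v (f i) + v (sum f I)"
    by (intro triangle sf_sum[OF subfield]) auto
  then show ?case using insert by fastforce
qed auto

text \<open>\<open>place_over\<close> asks only for the triangle inequality. Binomial coefficients
  have value at most 1, so expanding (x + y)^n bounds its value by (n + 1) M^n, and a ratio whose
  powers grow at most linearly is at most 1.\<close>

lemma ultrametric:
  assumes x: "x \<in> F" and y: "y \<in> F" and "v x \<le> M" "v y \<le> M"
  shows "v (x + y) \<le> M"
proof (cases "M = 0")
  case True
  then have "x = 0" "y = 0"
    using assms nonneg[of x] nonneg[of y] eq_0_iff by force+
  then show ?thesis using True by simp
next
  case False
  then have M: "M > 0" using nonneg[of x] assms(3) by linarith
  have xy: "x + y \<in> F" using x y subfield sf_add by blast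
  have "(v (x + y) / M) ^ n \<le> real n + 1" for n
  proof -
    have "v (x + y) ^ n = v (\<Sum>k\<le>n. of_nat (n choose k) * x ^ k * y ^ (n - k))"
      using xy by (simp add: binomial_ring power flip: power)
    also have "\<dots> \<le> (\<Sum>k\<le>n. v (of_nat (n choose k) * x ^ k * y ^ (n - k)))"
      by (intro sum_le sf_mult[OF subfield] sf_of_nat[OF subfield] sf_power[OF subfield] x y)
    also have "\<dots> \<le> (\<Sum>k\<le>n. M ^ n)"
    proof (rule sum_mono)
      fix k assume k: "k \<in> {..n}"
      have "v (of_nat (n choose k) * x ^ k * y ^ (n - k)) = v (of_nat (n choose k)) * v x ^ k * v y ^ (n - k)"
        using x y by (simp add: mult power sf_mult[OF subfield] sf_of_nat[OF subfield] sf_power[OF subfield])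
      also have "\<dots> \<le> 1 * M ^ k * M ^ (n - k)"
        using assms M of_nat_le_1 by (intro mult_mono power_mono) auto
      also have "\<dots> = M ^ n" using k by (simp flip: power_add)
      finally show "v (of_nat (n choose k) * x ^ k * y ^ (n - k)) \<le> M ^ n" .
    qed
    finally show ?thesis using M by (simp add: power_divide field_simps)
  qed
  then have "v (x + y) / M \<le> 1" by (rule exponential_le_linear)
  then show ?thesis using M by simp
qed

lemma ultrametric_diff:
  "x \<in> F \<Longrightarrow> y \<in> F \<Longrightarrow> v x \<le> M \<Longrightarrow> v y \<le> M \<Longrightarrow> v (x - y) \<le> M"
  using ultrametric[of x "- y" M] by (simp add: minus sf_uminus[OF subfield])

lemma ultrametric_sum:
  "(\<And>i. i \<in> I \<Longrightarrow> f i \<in> F) \<Longrightarrow> (\<And>i. i \<in> I \<Longrightarrow> v (f i) \<le> M) \<Longrightarrow> 0 \<le> M \<Longrightarrow> v (sum f I) \<le> M"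
proof (induction I rule: infinite_finite_induct)
  case (insert i I)
  then have "v (f i + sum f I) \<le> M"
    by (intro ultrametric sf_sum[OF subfield]) auto
  then show ?case using insert by simp
qed auto

lemma ultrametric_strict:
  assumes x: "x \<in> F" and y: "y \<in> F" and less: "v x < v y"
  shows "v (x + y) = v y"
proof (rule antisym)
  show "v (x + y) \<le> v y" using ultrametric[OF x y] less by auto
  show "v y \<le> v (x + y)"
  proof (rule ccontr)
    assume "\<not> v y \<le> v (x + y)"
    then have "v (x + y - x) \<le> max (v (x + y)) (v x)"
      by (intro ultrametric_diff sf_add[OF subfield] x y) auto
    then show False using less \<open>\<not> v y \<le> v (x + y)\<close> by simp
  qed
qed

end

section \<open>Valuation rings\<close>

text \<open>The last two assumptions fix the trace on the rationals: A meets them in the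
  localisation of the integers at p. The locale covers both the unit ball of a place and the maximal
  subring from Zorn's lemma, for which no absolute value is known beforehand.\<close>

locale valuation_ring =
  fixes F A p
  assumes subfield: "complex_subfield F" and prime: "prime p"
    and subset: "A \<subseteq> F" and one: "1 \<in> A"
    and add: "x \<in> A \<Longrightarrow> y \<in> A \<Longrightarrow> x + y \<in> A"
    and diff: "x \<in> A \<Longrightarrow> y \<in> A \<Longrightarrow> x - y \<in> A"
    and mult: "x \<in> A \<Longrightarrow> y \<in> A \<Longrightarrow> x * y \<in> A"
    and total: "x \<in> F \<Longrightarrow> x \<in> A \<or> inverse x \<in> A"
    and inverse_p: "inverse (of_nat p) \<notin> A"
    and inverse_int: "\<not> int p dvd m \<Longrightarrow> inverse (of_int m) \<in> A"
begin

definition unit :: "complex \<Rightarrow> bool" where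
  "unit x \<longleftrightarrow> x \<noteq> 0 \<and> x \<in> A \<and> inverse x \<in> A"

lemma zero: "0 \<in> A" using diff[OF one one] by simp

lemma unit_mult: "unit x \<Longrightarrow> unit y \<Longrightarrow> unit (x * y)"
  by (auto simp: unit_def mult)

lemma unit_inverse: "unit x \<Longrightarrow> unit (inverse x)"
  by (auto simp: unit_def)

lemma unit_divide: "unit x \<Longrightarrow> unit y \<Longrightarrow> unit (x / y)"
  by (simp add: divide_inverse unit_mult unit_inverse)

lemma unit_power: "unit x \<Longrightarrow> unit (x ^ k)"
  using one by (induction k) (auto simp: unit_mult unit_def[of 1])

lemma of_int: "of_int m \<in> A"
proof -
  have "of_nat n \<in> A" for n by (induction n) (auto simp: zero one add)
  then show ?thesis using diff[OF zero] by (cases m rule: int_cases2) fastforce+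
qed

lemma power: "x \<in> A \<Longrightarrow> x ^ k \<in> A"
  by (induction k) (auto simp: one mult)

lemma p_nonzero: "(of_nat p :: complex) \<noteq> 0"
  using prime by auto

text \<open>Divisibility in A is total. If, say, y divides x, then x + y is a multiple of y in A,
  and were it a unit, y would be one too.\<close>

lemma nonunit_add:
  assumes "x \<in> A" "y \<in> A" "\<not> unit x" "\<not> unit y"
  shows "\<not> unit (x + y)"
proof (cases "x = 0 \<or> y = 0")
  case False
  have *: False if "x \<in> A" "y \<in> A" "\<not> unit y" "x \<noteq> 0" "y \<noteq> 0" "x / y \<in> A" "unit (x + y)" for x y
  proof -
    have "inverse (x + y) * (1 + x / y) \<in> A" using that by (intro mult add one) (auto simp: unit_def)
    moreover have "inverse (x + y) * (1 + x / y) = inverse y"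
      using that by (auto simp: unit_def field_simps)
    ultimately show False using that by (auto simp: unit_def)
  qed
  have "x / y \<in> F" using assms subset sf_divide[OF subfield] by blast
  then have "x / y \<in> A \<or> y / x \<in> A" using total[of "x / y"] by auto
  then show ?thesis using *[of x y] *[of y x] assms False by (auto simp: add.commute)
qed (use assms in auto)

lemma nonunit_sum:
  "finite I \<Longrightarrow> (\<And>i. i \<in> I \<Longrightarrow> f i \<in> A \<and> \<not> unit (f i)) \<Longrightarrow> sum f I \<in> A \<and> \<not> unit (sum f I)"
proof (induction I rule: finite_induct)
  case empty
  show ?case by (auto simp: zero unit_def)
next
  case (insert i I)
  then show ?case by (auto simp: add nonunit_add)
qed

text \<open>This replaces a maximum over a valuation that is not yet available: divisibility in A is
  total and transitive, so a finite family has a member dividing all others.\<close>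

lemma dominant_term:
  "finite I \<Longrightarrow> I \<noteq> {} \<Longrightarrow> (\<And>i. i \<in> I \<Longrightarrow> t i \<in> F \<and> t i \<noteq> 0) \<Longrightarrow>
     \<exists>i0\<in>I. \<forall>i\<in>I. t i / t i0 \<in> A"
proof (induction I rule: finite_ne_induct)
  case (singleton x)
  then show ?case by (auto simp: one)
next
  case (insert j I)
  then obtain i0 where i0: "i0 \<in> I" "\<forall>i\<in>I. t i / t i0 \<in> A" by blast
  have "t j / t i0 \<in> F" using insert i0 sf_divide[OF subfield] by auto
  then consider "t j / t i0 \<in> A" | "t i0 / t j \<in> A" using total[of "t j / t i0"] by auto
  then show ?case
  proof cases
    case 1
    then show ?thesis using i0 by auto
  next
    case 2
    have "t i / t j \<in> A" if "i \<in> I" for i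
    proof -
      have "t i / t i0 * (t i0 / t j) \<in> A" using i0 that 2 by (intro mult) auto
      then show ?thesis using insert.prems i0 by auto
    qed
    then show ?thesis using insert.prems one by auto
  qed
qed

lemma unit_of_int:
  assumes "m \<noteq> 0"
  shows "\<exists>k::int. unit (of_int m * of_nat p powi k)"
proof -
  obtain m' where m': "m = int p ^ multiplicity (int p) m * m'" "\<not> int p dvd m'"
    using multiplicity_decompose'[of m "int p"] assms prime_gt_1_nat[OF prime] by auto
  let ?k = "multiplicity (int p) m"
  have "(of_int m :: complex) = of_nat p ^ ?k * of_int m'"
    by (subst m'(1)) simp
  then have "of_int m * of_nat p powi (- int ?k) = (of_int m' :: complex)"
    using p_nonzero by (simp add: power_int_minus field_simps)
  moreover have "unit (of_int m')" using m' inverse_int of_int by (auto simp: unit_def)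
  ultimately show ?thesis by metis
qed

text \<open>Two terms of the vanishing sum must share the largest value, and their quotient determines
the value of \<^term>\<open>x\<close>.\<close>

lemma algebraic_unit_power:
  assumes x: "x \<in> F" "x \<noteq> 0" and a: "\<exists>i\<le>N. a i \<noteq> 0" "(\<Sum>i\<le>N. of_int (a i) * x ^ i) = 0"
  shows "\<exists>d k. 0 < d \<and> d \<le> N \<and> unit (x ^ d * of_nat p powi k)"
proof -
  define I where "I = {i. i \<le> N \<and> a i \<noteq> 0}"
  define t where "t i = of_int (a i) * x ^ i" for i
  have I: "finite I" "I \<noteq> {}" using a by (auto simp: I_def)
  have t: "t i \<in> F \<and> t i \<noteq> 0" if "i \<in> I" for i
    using that x sf_mult[OF subfield sf_of_int[OF subfield] sf_power[OF subfield]]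
    by (auto simp: I_def t_def)
  have "\<exists>i0\<in>I. \<forall>i\<in>I. t i / t i0 \<in> A" by (rule dominant_term[OF I t])
  then obtain i0 where i0: "i0 \<in> I" "\<forall>i\<in>I. t i / t i0 \<in> A" ..
  have "(\<Sum>i\<in>I. t i) = (\<Sum>i\<le>N. of_int (a i) * x ^ i)"
    unfolding t_def by (intro sum.mono_neutral_left) (auto simp: I_def)
  then have sum0: "(\<Sum>i\<in>I. t i) = 0" using a by simp
  \<comment> \<open>If all other quotients were nonunits, so would be their sum, which is
    -1.\<close>
  have "\<exists>i1\<in>I. i1 \<noteq> i0 \<and> unit (t i1 / t i0)"
  proof (rule ccontr)
    assume "\<not> ?thesis"
    then have "\<not> unit (\<Sum>i\<in>I - {i0}. t i / t i0)"
      using i0 I nonunit_sum[of "I - {i0}" "\<lambda>i. t i / t i0"] by auto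
    moreover have "(\<Sum>i\<in>I - {i0}. t i / t i0) = - 1"
    proof -
      have "t i0 + (\<Sum>i\<in>I - {i0}. t i) = 0" using sum0 I i0 by (simp add: sum.remove)
      then have "(\<Sum>i\<in>I - {i0}. t i) = - t i0" by (simp add: add_eq_0_iff)
      then show ?thesis using t[OF i0(1)] by (simp flip: sum_divide_distrib)
    qed
    ultimately show False using diff[OF zero one] by (auto simp: unit_def)
  qed
  then obtain i1 where i1: "i1 \<in> I" "i1 \<noteq> i0" "unit (t i1 / t i0)" by auto
  obtain k0 where k0: "unit (of_int (a i0) * of_nat p powi k0)"
    using unit_of_int i0 by (auto simp: I_def)
  obtain k1 where k1: "unit (of_int (a i1) * of_nat p powi k1)"
    using unit_of_int i1 by (auto simp: I_def)
  let ?P = "of_nat p :: complex"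
  \<comment> \<open>The integer coefficients differ from powers of p only by units; dividing them
    out leaves an expression in x and p alone.\<close>
  have u: "unit ((t i1 / t i0) * ((of_int (a i0) * ?P powi k0) / (of_int (a i1) * ?P powi k1)))"
    by (intro unit_mult unit_divide i1 k0 k1)
  have "(t i1 / t i0) * ((of_int (a i0) * ?P powi k0) / (of_int (a i1) * ?P powi k1)) =
        x ^ i1 / x ^ i0 * ?P powi (k0 - k1)"
    using i0 i1 p_nonzero x by (simp add: t_def I_def power_int_diff)
  with u have u: "unit (x ^ i1 / x ^ i0 * ?P powi (k0 - k1))" by simp
  \<comment> \<open>The exponent of x has to be positive, so for i1 < i0 the unit is
    inverted.\<close>
  show ?thesis
  proof (cases "i0 < i1")
    case True
    then have "x ^ i1 / x ^ i0 = x ^ (i1 - i0)" using x by (simp add: power_diff)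
    then show ?thesis using u True i1
      by (intro exI[of _ "i1 - i0"] exI[of _ "k0 - k1"]) (auto simp: I_def)
  next
    case False
    then have "inverse (x ^ i1 / x ^ i0 * ?P powi (k0 - k1)) = x ^ (i0 - i1) * ?P powi (k1 - k0)"
      using x p_nonzero i1 by (simp add: power_diff power_int_diff)
    then show ?thesis using unit_inverse[OF u] False i1 i0
      by (intro exI[of _ "i0 - i1"] exI[of _ "k1 - k0"]) (auto simp: I_def)
  qed
qed

end

section \<open>Values of a place on algebraic elements\<close>

context place
begin

lemma valuation_ring: "valuation_ring F {x \<in> F. v x \<le> 1} p"
proof
  show "inverse (of_nat p) \<notin> {x \<in> F. v x \<le> 1}"
    using p_gt_1 by (auto simp: inverse of_nat_p p_in)
  show "x \<in> {x \<in> F. v x \<le> 1} \<or> inverse x \<in> {x \<in> F. v x \<le> 1}" if "x \<in> F" for x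
    using that inverse[OF that] sf_inverse[OF subfield that] one_le_inverse_iff[of "v x"] inverse_le_1_iff[of "v x"]
    by auto
  show "inverse (of_int m) \<in> {x \<in> F. v x \<le> 1}" if "\<not> int p dvd m" for m
    using that by (auto simp: inverse sf_of_int[OF subfield] sf_inverse[OF subfield] of_int_eq_1)
qed (auto simp: subfield prime sf_1[OF subfield] sf_add[OF subfield] sf_diff[OF subfield]
      sf_mult[OF subfield] ultrametric ultrametric_diff mult mult_le_one)

lemma power_eq_imp_powr:
  assumes "v x > 0" "v x ^ d * real p powr k = 1" "d > 0"
  shows "v x = real p powr (- k / real d)"
proof -
  have "v x ^ d = real p powr (- k)"
    using assms p_gt_1 by (simp add: powr_minus field_simps)
  then have "(v x ^ d) powr (1 / real d) = real p powr (- k / real d)"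
    by (simp add: powr_powr)
  moreover have "(v x ^ d) powr (1 / real d) = v x"
    using assms by (simp add: powr_powr flip: powr_realpow)
  ultimately show ?thesis by simp
qed

lemma of_nat_p_powi: "v (of_nat p powi k) = real p powr (- real_of_int k)"
proof -
  have "v (of_nat p powi k) = (real p powr - 1) powi k"
    using p_gt_1 by (simp add: power_int p_in of_nat_p powr_minus_divide)
  also have "\<dots> = (real p powr - 1) powr real_of_int k"
    using p_gt_1 by (intro powr_real_of_int'[symmetric]) auto
  also have "\<dots> = real p powr (- real_of_int k)" by (simp only: powr_powr) simp
  finally show ?thesis .
qed

text \<open>The unit ball is a valuation ring, so some x^d p^k with d \<le> N has value 1. Every
  such d divides N!, so the denominator depends on the degree bound only.\<close>

lemma value_powr_fact:
  assumes x: "x \<in> F" "x \<noteq> 0" and a: "\<exists>i\<le>N. a i \<noteq> 0" "(\<Sum>i\<le>N. of_int (a i) * x ^ i) = 0"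
  shows "\<exists>j::int. v x = real p powr (j / fact N)"
proof -
  interpret V: valuation_ring F "{x \<in> F. v x \<le> 1}" p by (rule valuation_ring)
  obtain d k where dk: "0 < d" "d \<le> N" "V.unit (x ^ d * of_nat p powi k)"
    using V.algebraic_unit_power[OF x a] by blast
  have in_F: "x ^ d * of_nat p powi k \<in> F"
    using x by (intro sf_mult[OF subfield] sf_power[OF subfield] sf_power_int[OF subfield] p_in)
  then have "v (x ^ d * of_nat p powi k) = 1"
    using dk(3) pos[OF in_F] inverse[OF in_F] unfolding V.unit_def
    by (simp del: inverse_mult_distrib add: inverse_le_1_iff)
  then have "v x ^ d * real p powr (- real_of_int k) = 1"
    using x by (simp add: mult power sf_power[OF subfield] sf_power_int[OF subfield] p_in of_nat_p_powi)
  then have *: "v x = real p powr (real_of_int k / real d)"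
    using power_eq_imp_powr[of x d "- real_of_int k"] pos[OF x] dk by simp
  obtain c where c: "(fact N :: nat) = d * c" using dk dvd_fact[of d N] by (auto simp: dvd_def)
  then have "c > 0" by (metis fact_nonzero mult_0_right not_gr0)
  have "(fact N :: real) = real d * real c"
    using c by (metis of_nat_fact of_nat_mult)
  then have "real_of_int k / real d = real_of_int (k * int c) / fact N"
    using dk \<open>c > 0\<close> by simp
  then show ?thesis using * by metis
qed

end

section \<open>Extension of places\<close>

definition subring_in :: "complex set \<Rightarrow> complex set \<Rightarrow> bool" where
  "subring_in F A \<longleftrightarrow> A \<subseteq> F \<and> 1 \<in> A \<and> (\<forall>x\<in>A. \<forall>y\<in>A. x + y \<in> A \<and> x - y \<in> A \<and> x * y \<in> A)"

definition adjoin :: "complex set \<Rightarrow> complex \<Rightarrow> complex set" where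
  "adjoin A x = {poly f x | f. \<forall>i. coeff f i \<in> A}"

context
  fixes F A
  assumes sub: "subring_in F A"
begin

lemma sr_subset: "A \<subseteq> F" and sr_1: "1 \<in> A"
  and sr_add: "x \<in> A \<Longrightarrow> y \<in> A \<Longrightarrow> x + y \<in> A"
  and sr_diff: "x \<in> A \<Longrightarrow> y \<in> A \<Longrightarrow> x - y \<in> A"
  and sr_mult: "x \<in> A \<Longrightarrow> y \<in> A \<Longrightarrow> x * y \<in> A"
  using sub by (auto simp: subring_in_def)

lemma sr_0: "0 \<in> A" using sr_diff[OF sr_1 sr_1] by simp

lemma sr_sum: "(\<And>i. i \<in> I \<Longrightarrow> f i \<in> A) \<Longrightarrow> sum f I \<in> A"
  by (induction I rule: infinite_finite_induct) (auto simp: sr_0 sr_add)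

lemma sr_power: "x \<in> A \<Longrightarrow> x ^ k \<in> A"
  by (induction k) (auto simp: sr_1 sr_mult)

lemma sr_of_nat: "of_nat n \<in> A"
  by (induction n) (auto simp: sr_0 sr_1 sr_add)

lemma adjoin_superset: "A \<subseteq> adjoin A x"
proof
  fix a assume "a \<in> A"
  then show "a \<in> adjoin A x"
    unfolding adjoin_def by (intro CollectI exI[of _ "[:a:]"]) (auto simp: coeff_pCons sr_0 split: nat.split)
qed

lemma adjoin_self: "x \<in> adjoin A x"
  unfolding adjoin_def by (intro CollectI exI[of _ "[:0, 1:]"]) (auto simp: coeff_pCons sr_0 sr_1 split: nat.split)

lemma subring_adjoin:
  assumes F: "complex_subfield F" and x: "x \<in> F"
  shows "subring_in F (adjoin A x)"
  unfolding subring_in_def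
proof (intro conjI ballI)
  show "adjoin A x \<subseteq> F"
    using sr_subset unfolding adjoin_def poly_altdef
    by (auto intro!: sf_sum[OF F] sf_mult[OF F] sf_power[OF F] x)
  show "1 \<in> adjoin A x" using adjoin_superset sr_1 by auto
  fix y z assume "y \<in> adjoin A x" "z \<in> adjoin A x"
  then obtain f g where fg: "\<And>i. coeff f i \<in> A" "y = poly f x" "\<And>i. coeff g i \<in> A" "z = poly g x"
    by (auto simp: adjoin_def)
  show "y + z \<in> adjoin A x" unfolding adjoin_def using fg
    by (intro CollectI exI[of _ "f + g"]) (auto simp: sr_add)
  show "y - z \<in> adjoin A x" unfolding adjoin_def using fg
    by (intro CollectI exI[of _ "f - g"]) (auto simp: sr_diff)
  show "y * z \<in> adjoin A x" unfolding adjoin_def using fg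
    by (intro CollectI exI[of _ "f * g"]) (auto simp: coeff_mult intro!: sr_sum sr_mult)
qed

end

section \<open>Chevalley's argument for maximal subrings\<close>

locale maximal_subring =
  fixes F A and P :: complex
  assumes F: "complex_subfield F" and sub: "subring_in F A"
    and P: "P \<in> A" "P \<noteq> 0" "inverse P \<notin> A"
    and maximal: "subring_in F B \<Longrightarrow> A \<subseteq> B \<Longrightarrow> inverse P \<notin> B \<Longrightarrow> B = A"
begin

lemma adjoin_contains_inverse: "x \<in> F \<Longrightarrow> x \<notin> A \<Longrightarrow> inverse P \<in> adjoin A x"
  using maximal[OF subring_adjoin[OF sub F] adjoin_superset[OF sub]] adjoin_self[OF sub] by metis

lemma one_minus_nonzero: "b \<in> A \<Longrightarrow> 1 - P * b \<noteq> 0"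
  using P by (metis eq_iff_diff_eq_0 inverse_unique)

text \<open>P lies in the Jacobson radical of A. Otherwise adjoining 1/c for some c = 1 - P b would
  produce 1/P as a polynomial in 1/c; clearing denominators puts c^N into P A, while c^N is 1 modulo
  P, so P would be invertible in A.\<close>

lemma inverse_one_minus:
  assumes b: "b \<in> A"
  shows "inverse (1 - P * b) \<in> A"
proof (rule ccontr)
  define c where "c = 1 - P * b"
  have c: "c \<in> A" "c \<noteq> 0"
    using b P one_minus_nonzero by (auto simp: c_def intro!: sr_diff[OF sub] sr_1[OF sub] sr_mult[OF sub])
  assume "inverse (1 - P * b) \<notin> A"
  then have "inverse P \<in> adjoin A (inverse c)"
    using c sr_subset[OF sub] sf_inverse[OF F] by (intro adjoin_contains_inverse) (auto simp: c_def)
  then obtain f where f: "\<And>i. coeff f i \<in> A" "inverse P = poly f (inverse c)"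
    by (auto simp: adjoin_def)
  let ?N = "degree f"
  let ?a = "\<Sum>i\<le>?N. coeff f i * c ^ (?N - i)"
  have a: "?a \<in> A" using f c by (intro sr_sum[OF sub] sr_mult[OF sub] sr_power[OF sub])
  have "c ^ ?N * inverse P = ?a"
    unfolding f(2) poly_altdef sum_distrib_left using c
    by (intro sum.cong refl) (auto simp: power_diff power_inverse field_simps)
  then have cN: "c ^ ?N = P * ?a" using P by (simp add: field_simps)
  have "\<exists>b'\<in>A. c ^ n = 1 - P * b'" for n
  proof (induction n)
    case 0
    show ?case using sr_0[OF sub] by (intro bexI[of _ 0]) auto
  next
    case (Suc n)
    then obtain b' where b': "b' \<in> A" "c ^ n = 1 - P * b'" by auto
    have "c ^ Suc n = 1 - P * (b' + b - P * (b * b'))" 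
      by (simp only: power_Suc b'(2)) (simp add: c_def algebra_simps)
    then show ?case using b b' P
      by (intro bexI[of _ "b' + b - P * (b * b')"]) (auto intro!: sr_diff[OF sub] sr_add[OF sub] sr_mult[OF sub])
  qed
  then obtain b' where b': "b' \<in> A" "c ^ ?N = 1 - P * b'" by blast
  have "P * (?a + b') = 1" using cN b' by (simp add: algebra_simps)
  then have "inverse P = ?a + b'" by (rule inverse_unique)
  then show False using P sr_add[OF sub a b'(1)] by simp
qed

text \<open>In the relation for 1/x the factor 1 - P g_0 is invertible, so 1 is a combination of
  x^-1, ..., x^-m over A. Multiplying the top term of f by this combination replaces it by lower
  powers of x; m \<le> n keeps the exponents nonnegative.\<close>

lemma chevalley_degree:
  assumes f: "\<And>i. coeff f i \<in> A" "P * poly f x = 1" "degree f = n"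
    and g: "\<And>i. coeff g i \<in> A" "P * poly g (inverse x) = 1" "degree g \<le> n"
    and x: "x \<noteq> 0"
  shows "\<exists>h. (\<forall>i. coeff h i \<in> A) \<and> P * poly h x = 1 \<and> degree h < n"
proof -
  define m where "m = degree g"
  have n: "n > 0"
  proof (rule ccontr)
    assume "\<not> n > 0"
    then have "P * coeff f 0 = 1" using f(2,3) by (simp add: poly_altdef)
    then show False using P f(1) by (metis inverse_unique)
  qed
  define c where "c = 1 - P * coeff g 0"
  have c: "c \<noteq> 0" "inverse c \<in> A"
    using one_minus_nonzero inverse_one_minus g(1) by (auto simp: c_def)
  define e where "e j = P * coeff g j * inverse c" for j
  have e: "e j \<in> A" for j using P g c by (auto simp: e_def intro!: sr_mult[OF sub])
  have e_sum: "(\<Sum>j=1..m. e j * inverse x ^ j) = 1"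
  proof -
    have "poly g (inverse x) = (\<Sum>j\<in>insert 0 {1..m}. coeff g j * inverse x ^ j)"
      unfolding poly_altdef m_def by (intro sum.cong) auto
    also have "\<dots> = coeff g 0 + (\<Sum>j=1..m. coeff g j * inverse x ^ j)" by simp
    finally have "P * (\<Sum>j=1..m. coeff g j * inverse x ^ j) = c"
      using g(2) by (simp add: c_def algebra_simps)
    then have "inverse c * (P * (\<Sum>j=1..m. coeff g j * inverse x ^ j)) = 1" using c by simp
    then show ?thesis by (simp add: e_def sum_distrib_left mult_ac)
  qed
  define h where "h = f - monom (coeff f n) n + (\<Sum>j=1..m. monom (coeff f n * e j) (n - j))"
  have mn: "m \<le> n" using g(3) by (simp add: m_def)
  have "coeff h i \<in> A" for i
    unfolding h_def coeff_add coeff_diff coeff_sum coeff_monom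
    using f(1) e by (intro sr_add[OF sub] sr_diff[OF sub] sr_sum[OF sub]) (auto intro: sr_mult[OF sub] sr_0[OF sub])
  moreover have "poly h x = poly f x"
  proof -
    have "poly h x = poly f x - coeff f n * x ^ n + (\<Sum>j=1..m. coeff f n * e j * x ^ (n - j))"
      by (simp add: h_def poly_sum poly_monom)
    also have "(\<Sum>j=1..m. coeff f n * e j * x ^ (n - j)) = coeff f n * x ^ n * (\<Sum>j=1..m. e j * inverse x ^ j)"
      unfolding sum_distrib_left using x mn
      by (intro sum.cong refl) (auto simp: power_diff field_simps power_inverse)
    finally show ?thesis using e_sum by simp
  qed
  moreover have "degree h \<le> n - 1"
  proof (rule degree_le, intro allI impI)
    fix i assume i: "n - 1 < i"
    have "coeff f i - coeff (monom (coeff f n) n) i = 0"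
      using i f(3) n by (auto simp: coeff_eq_0)
    moreover have "(\<Sum>j=1..m. coeff (monom (coeff f n * e j) (n - j)) i) = 0"
      using i n by (intro sum.neutral) auto
    ultimately show "coeff h i = 0" unfolding h_def coeff_add coeff_diff coeff_sum by simp
  qed
  ultimately show ?thesis using f(2) n by (intro exI[of _ h]) auto
qed

text \<open>Chevalley: relations of least degree for \<^term>\<open>x\<close> and \<^term>\<open>inverse x\<close>
reduce each other.\<close>

lemma total: "x \<in> F \<Longrightarrow> x \<in> A \<or> inverse x \<in> A"
proof (rule ccontr)
  assume x: "x \<in> F" and "\<not> (x \<in> A \<or> inverse x \<in> A)"
  then have nin: "x \<notin> A" "inverse x \<notin> A" by auto
  then have x0: "x \<noteq> 0" using sr_0[OF sub] by auto
  define rel where "rel y f \<longleftrightarrow> (\<forall>i. coeff f i \<in> A) \<and> P * poly f y = 1" for y f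
  have ex: "\<exists>f. rel y f" if y: "y \<in> F" "y \<notin> A" for y
  proof -
    obtain f where "\<And>i. coeff f i \<in> A" "inverse P = poly f y"
      using adjoin_contains_inverse[OF y] by (auto simp: adjoin_def)
    then show ?thesis using P by (metis rel_def right_inverse)
  qed
  have "\<exists>f. rel y f \<and> (\<forall>g. rel y g \<longrightarrow> degree f \<le> degree g)" if y: "y \<in> F" "y \<notin> A" for y
    using ex_has_least_nat[of "rel y" _ degree] ex[OF y] by blast
  then obtain f g where f: "rel x f" "\<And>h. rel x h \<Longrightarrow> degree f \<le> degree h"
    and g: "rel (inverse x) g" "\<And>h. rel (inverse x) h \<Longrightarrow> degree g \<le> degree h"
    using x nin sf_inverse[OF F x] by metis
  show False
  proof (cases "degree g \<le> degree f")
    case True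
    then obtain h where "rel x h" "degree h < degree f"
      using chevalley_degree[of f x "degree f" g] f(1) g(1) x0 by (auto simp: rel_def)
    then show False using f(2) by fastforce
  next
    case False
    then obtain h where "rel (inverse x) h" "degree h < degree g"
      using chevalley_degree[of g "inverse x" "degree g" f] f(1) g(1) x0 by (auto simp: rel_def)
    then show False using g(2) by fastforce
  qed
qed

end

section \<open>The absolute value attached to a valuation ring\<close>

locale algebraic_valuation_ring = valuation_ring +
  assumes algebraic: "x \<in> F \<Longrightarrow> \<exists>N a. (\<Sum>i\<le>N. of_int (a i) * x ^ i) = 0 \<and> (\<exists>i\<le>N. a i \<noteq> 0)"
begin

abbreviation "P \<equiv> of_nat p :: complex"

lemma P_in: "P \<in> A" using of_int[of "int p"] by simp

lemma not_unit_powi_pos: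
  assumes "k > 0" shows "\<not> unit (P powi k)"
proof
  assume "unit (P powi k)"
  then have "inverse (P powi k) * P ^ (nat k - 1) \<in> A"
    using P_in by (auto simp: unit_def intro!: mult power)
  moreover have "P powi k = P ^ Suc (nat k - 1)" using assms by (simp add: power_int_def)
  moreover have "inverse (P ^ Suc n) * P ^ n = inverse P" for n using p_nonzero by (simp add: field_simps)
  ultimately show False using inverse_p by metis
qed

lemma unit_powi_iff: "unit (P powi k) \<longleftrightarrow> k = 0"
proof -
  have "unit (P powi 0)" by (simp add: unit_def one)
  moreover have "\<not> unit (P powi k)" if "k < 0"
    using not_unit_powi_pos[of "- k"] unit_inverse[of "P powi k"] that
    by (auto simp: power_int_minus)
  ultimately show ?thesis using not_unit_powi_pos[of k] by (cases k "0::int" rule: linorder_cases) auto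
qed

text \<open>Raising the two units to crossed powers and dividing eliminates x, and the only power of
  p that is a unit is the trivial one.\<close>

lemma exponent_unique:
  assumes "x \<noteq> 0" "d > 0" "e > 0" "unit (x ^ d * P powi k)" "unit (x ^ e * P powi l)"
  shows "real_of_int k / real d = real_of_int l / real e"
proof -
  have "unit ((x ^ d * P powi k) ^ e / (x ^ e * P powi l) ^ d)"
    using assms by (intro unit_divide unit_power)
  moreover have "(x ^ d * P powi k) ^ e / (x ^ e * P powi l) ^ d = P powi (k * int e - l * int d)"
    using assms(1) p_nonzero
    by (simp add: power_mult_distrib power_int_diff power_int_mult mult.commute flip: power_mult)
  ultimately have "k * int e = l * int d" by (simp add: unit_powi_iff)
  then have "real_of_int k * real e = real_of_int l * real d"
    by (metis of_int_mult of_int_of_nat_eq)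
  then show ?thesis using assms by (simp add: field_simps)
qed

lemma exponent_exists:
  assumes "x \<in> F" "x \<noteq> 0"
  obtains d k where "d > 0" "unit (x ^ d * P powi k)"
proof -
  obtain N a where "(\<Sum>i\<le>N. of_int (a i) * x ^ i) = 0" "\<exists>i\<le>N. a i \<noteq> 0"
    using algebraic[OF assms(1)] by blast
  then show ?thesis using algebraic_unit_power[OF assms] that by blast
qed

text \<open>A unit must get value 1, so x^d p^k being one forces |x| = p^(k/d) under the
  normalisation |p| = 1/p. The choice is harmless by \<open>exponent_unique\<close>.\<close>

definition abs_val :: "complex \<Rightarrow> real" where
  "abs_val x = (if x \<in> F \<and> x \<noteq> 0 then
     real p powr (SOME r. \<exists>d k. d > 0 \<and> unit (x ^ d * P powi k) \<and> r = real_of_int k / real d) else 0)"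

lemma abs_val_eq:
  assumes "x \<in> F" "x \<noteq> 0" "d > 0" "unit (x ^ d * P powi k)"
  shows "abs_val x = real p powr (real_of_int k / real d)"
proof -
  have "(SOME r. \<exists>d k. d > 0 \<and> unit (x ^ d * P powi k) \<and> r = real_of_int k / real d) = real_of_int k / real d"
    using assms exponent_unique[of x] by (intro some_equality) blast+
  then show ?thesis using assms by (simp add: abs_val_def)
qed

lemma abs_val_mult:
  assumes x: "x \<in> F" and y: "y \<in> F"
  shows "abs_val (x * y) = abs_val x * abs_val y"
proof (cases "x = 0 \<or> y = 0")
  case False
  obtain d k where dk: "d > 0" "unit (x ^ d * P powi k)" using exponent_exists x False by metis
  obtain e l where el: "e > 0" "unit (y ^ e * P powi l)" using exponent_exists y False by metis
  have "unit ((x ^ d * P powi k) ^ e * (y ^ e * P powi l) ^ d)"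
    by (rule unit_mult[OF unit_power[OF dk(2)] unit_power[OF el(2)]])
  moreover have "(x ^ d * P powi k) ^ e * (y ^ e * P powi l) ^ d =
      (x * y) ^ (d * e) * P powi (k * int e + l * int d)"
    using p_nonzero
    by (simp add: power_mult_distrib power_int_add power_int_mult power_mult)
       (simp add: mult_ac flip: power_mult)
  ultimately have "abs_val (x * y) = real p powr (real_of_int (k * int e + l * int d) / real (d * e))"
    using dk el False x y sf_mult[OF subfield] by (intro abs_val_eq) auto
  also have "real_of_int (k * int e + l * int d) / real (d * e) = real_of_int k / real d + real_of_int l / real e"
    using dk el by (simp add: field_simps)
  also have "real p powr \<dots> = abs_val x * abs_val y"
    using abs_val_eq[OF x _ dk] abs_val_eq[OF y _ el] False by (simp add: powr_add)
  finally show ?thesis .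
qed (auto simp: abs_val_def)

lemma p_gt_1: "real p > 1"
  using prime prime_gt_1_nat by simp

lemma abs_val_le_1_iff:
  assumes x: "x \<in> F"
  shows "abs_val x \<le> 1 \<longleftrightarrow> x \<in> A"
proof (cases "x = 0")
  case False
  obtain d k where dk: "d > 0" "unit (x ^ d * P powi k)" using exponent_exists x False by metis
  note eq = abs_val_eq[OF x False dk]
  have "abs_val x \<le> 1 \<longleftrightarrow> k \<le> 0"
    using dk p_gt_1 powr_le_cancel_iff[of "real p" "real_of_int k / real d" 0] unfolding eq
    by (simp add: divide_le_0_iff)
  also have "k \<le> 0 \<longleftrightarrow> x \<in> A"
  proof
    assume k: "k \<le> 0"
    have "x ^ d * P powi k * P ^ nat (- k) \<in> A"
      using dk P_in by (auto simp: unit_def intro!: mult power)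
    moreover have "P powi k * P ^ nat (- k) = 1"
      using k p_nonzero by (cases "k = 0") (auto simp: power_int_def power_inverse)
    ultimately have xd: "x ^ d \<in> A" by (simp add: mult.assoc)
    \<comment> \<open>Valuation rings are integrally closed: if x were outside A, then 1/x would lie
      in A, and so would x = x^d (1/x)^(d-1).\<close>
    show "x \<in> A"
    proof (rule ccontr)
      assume "x \<notin> A"
      then have "x ^ d * inverse x ^ (d - 1) \<in> A" using total[OF x] by (intro mult[OF xd] power) auto
      moreover have "x ^ d * inverse x ^ (d - 1) = x"
        using dk False by (cases d) (auto simp: power_inverse)
      ultimately show False using \<open>x \<notin> A\<close> by metis
    qed
  next
    assume xA: "x \<in> A"
    show "k \<le> 0"
    proof (rule ccontr)
      assume "\<not> k \<le> 0"
      then have Pk: "P powi k = P ^ Suc (nat k - 1)" by (simp add: power_int_def)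
      have "inverse (x ^ d * P powi k) * x ^ d * P ^ (nat k - 1) \<in> A"
        using dk P_in xA by (intro mult power) (auto simp: unit_def)
      moreover have "inverse (x ^ d * P powi k) * x ^ d * P ^ (nat k - 1) = inverse P"
        using False p_nonzero unfolding Pk by (simp add: field_simps)
      ultimately show False using inverse_p by simp
    qed
  qed
  finally show ?thesis .
qed (simp add: abs_val_def zero)

lemma abs_val_0: "abs_val 0 = 0" by (simp add: abs_val_def)

lemma abs_val_nonneg: "abs_val x \<ge> 0" by (simp add: abs_val_def)

text \<open>After division by the larger element, closure of A under addition is all that is used:
  x/y in A gives 1 + x/y in A. The inner claim is the ultrametric bound.\<close>

lemma abs_val_triangle:
  assumes x: "x \<in> F" and y: "y \<in> F"
  shows "abs_val (x + y) \<le> abs_val x + abs_val y"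
proof -
  have *: "abs_val (x + y) \<le> abs_val y" if "abs_val x \<le> abs_val y" "x \<in> F" "y \<in> F" "y \<noteq> 0" for x y
  proof -
    have xy: "x / y \<in> F" using that sf_divide[OF subfield] by auto
    have "abs_val y > 0" using that p_gt_1 by (auto simp: abs_val_def)
    moreover have "abs_val (x / y) * abs_val y = abs_val x"
      using abs_val_mult[OF xy \<open>y \<in> F\<close>] that by simp
    ultimately have "abs_val (x / y) \<le> 1" using that by (metis mult_1 mult_le_cancel_right_pos)
    then have "1 + x / y \<in> A" using abs_val_le_1_iff[OF xy] one add by auto
    then have "abs_val (1 + x / y) \<le> 1" using subset abs_val_le_1_iff by auto
    moreover have "x + y = (1 + x / y) * y" using that by (simp add: field_simps)
    ultimately show ?thesis
      using abs_val_mult[of "1 + x / y" y] that \<open>1 + x / y \<in> A\<close> subset abs_val_nonneg[of y]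
      by (simp add: mult_left_le_one_le abs_val_nonneg subset_iff)
  qed
  show ?thesis
    using *[of x y] *[of y x] x y abs_val_nonneg[of x] abs_val_nonneg[of y] abs_val_0
    by (cases "abs_val x \<le> abs_val y"; cases "x = 0"; cases "y = 0") (auto simp: add.commute)
qed

end

text \<open>Zorn's lemma yields a subring of \<open>Qbar\<close> maximal among those that contain
  the unit ball of v and miss 1/p. Missing 1/p keeps p a nonunit, and containing the unit ball makes
  the resulting absolute value agree with v on K.\<close>

lemma place_extends_to_Qbar:
  assumes K: "number_field K" and p: "prime p" and v: "place_over K p v"
  shows "\<exists>y. place_over Qbar p y \<and> divides_place K y v"
proof -
  interpret v: place K p v
    using assms number_field_subfield by unfold_locales auto
  have KQ: "K \<subseteq> Qbar" using K number_field_subset_Qbar by blast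
  define A0 where "A0 = {x \<in> K. v x \<le> 1}"
  interpret V: valuation_ring K A0 p unfolding A0_def by (rule v.valuation_ring)
  let ?P = "of_nat p :: complex"
  define \<A> where "\<A> = {A. subring_in Qbar A \<and> A0 \<subseteq> A \<and> inverse ?P \<notin> A}"
  have "A0 \<in> \<A>"
    using V.subset KQ V.one V.add V.diff V.mult V.inverse_p by (auto simp: \<A>_def subring_in_def)
  have "\<exists>M\<in>\<A>. \<forall>X\<in>\<A>. M \<subseteq> X \<longrightarrow> X = M"
  proof (rule subset_Zorn_nonempty)
    show "\<A> \<noteq> {}" using \<open>A0 \<in> \<A>\<close> by auto
    fix C assume C: "C \<noteq> {}" "subset.chain \<A> C"
    have CA: "X \<in> \<A>" if "X \<in> C" for X using C that by (auto simp: subset.chain_def)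
    have two: "\<exists>X\<in>C. x \<in> X \<and> y \<in> X" if xy: "x \<in> \<Union>C" "y \<in> \<Union>C" for x y
    proof -
      obtain X Y where XY: "X \<in> C" "x \<in> X" "Y \<in> C" "y \<in> Y" using xy by blast
      then have "X \<subseteq> Y \<or> Y \<subseteq> X" using C(2) unfolding subset_chain_def by blast
      then show ?thesis using XY by blast
    qed
    have "x + y \<in> \<Union>C \<and> x - y \<in> \<Union>C \<and> x * y \<in> \<Union>C" if xy: "x \<in> \<Union>C" "y \<in> \<Union>C" for x y
    proof -
      obtain X where X: "X \<in> C" "x \<in> X" "y \<in> X" using two[OF xy] by blast
      then show ?thesis using CA[OF X(1)] by (auto simp: \<A>_def subring_in_def)
    qed
    moreover have "\<Union>C \<subseteq> Qbar" "inverse ?P \<notin> \<Union>C"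
      using CA unfolding \<A>_def subring_in_def by blast+
    moreover have "1 \<in> \<Union>C" "A0 \<subseteq> \<Union>C"
      using CA C(1) by (auto simp: \<A>_def subring_in_def)
    ultimately show "\<Union>C \<in> \<A>"
      unfolding \<A>_def subring_in_def by simp
  qed
  then obtain A where A: "A \<in> \<A>" and max: "\<And>X. X \<in> \<A> \<Longrightarrow> A \<subseteq> X \<Longrightarrow> X = A" by blast
  have sub: "subring_in Qbar A" and A0: "A0 \<subseteq> A" and pA: "inverse ?P \<notin> A"
    using A by (auto simp: \<A>_def)
  interpret M: maximal_subring Qbar A ?P
  proof
    show "B = A" if "subring_in Qbar B" "A \<subseteq> B" "inverse ?P \<notin> B" for B
      using that A0 by (intro max) (auto simp: \<A>_def)
  qed (use sub pA V.p_nonzero Qbar_subfield sr_of_nat[OF sub] in auto)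
  interpret W: algebraic_valuation_ring Qbar A p
  proof
    show "inverse (of_int m) \<in> A" if "\<not> int p dvd m" for m
      using V.inverse_int[OF that] A0 by auto
    show "\<exists>N a. (\<Sum>i\<le>N. of_int (a i) * x ^ i) = 0 \<and> (\<exists>i\<le>N. a i \<noteq> 0)" if x: "x \<in> Qbar" for x
    proof -
      obtain L where "number_field L" "x \<in> L" using x by (auto simp: Qbar_def)
      then show ?thesis using number_field_primitive_relation[of L] by blast
    qed
  qed (use sub pA p M.total Qbar_subfield in \<open>auto simp: subring_in_def\<close>)
  \<comment> \<open>High powers u^n are divisible by p in the unit ball of v, hence in A; for a unit
    u of A this would put 1/p in A.\<close>
  have less: "\<not> v u < 1" if "u \<in> K" "W.unit u" for u
  proof
    assume "v u < 1"
    then obtain n where n: "v u ^ n < 1 / real p"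
      using real_arch_pow_inv[of "1 / real p" "v u"] v.p_gt_1 by auto
    have "v (u ^ n / ?P) \<le> 1"
      using n that v.p_gt_1
      by (simp add: v.divide v.power v.of_nat_p v.p_in sf_power[OF v.subfield] field_simps)
    then have "u ^ n / ?P \<in> A"
      using that A0 v.p_in sf_divide[OF v.subfield] sf_power[OF v.subfield] by (auto simp: A0_def)
    then have "u ^ n / ?P * inverse u ^ n \<in> A"
      using that by (intro W.mult W.power) (auto simp: W.unit_def)
    moreover have "u ^ n / ?P * inverse u ^ n = inverse ?P"
      using that by (auto simp: W.unit_def field_simps)
    ultimately show False using pA by simp
  qed
  have v_unit: "v u = 1" if u: "u \<in> K" "W.unit u" for u
  proof -
    have "\<not> inverse (v u) < 1"
      using less[OF sf_inverse[OF v.subfield u(1)] W.unit_inverse[OF u(2)]] v.inverse[OF u(1)] by simp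
    then show ?thesis using less[OF u] by (simp add: one_less_inverse_iff inverse_less_1_iff not_less)
  qed
  \<comment> \<open>Both absolute values of x are determined by one unit x^d p^k, to which v assigns
    1.\<close>
  have agree: "W.abs_val x = v x" if x: "x \<in> K" for x
  proof (cases "x = 0")
    case False
    obtain d k where dk: "d > 0" "W.unit (x ^ d * ?P powi k)"
      using W.exponent_exists x False KQ by blast
    have "v (x ^ d * ?P powi k) = 1"
      using dk x by (intro v_unit sf_mult[OF v.subfield] sf_power[OF v.subfield] sf_power_int[OF v.subfield] v.p_in)
    then have "v x ^ d * real p powr (- real_of_int k) = 1"
      using x by (simp add: v.mult v.power sf_power[OF v.subfield] sf_power_int[OF v.subfield] v.p_in v.of_nat_p_powi)
    then have "v x = real p powr (real_of_int k / real d)"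
      using v.power_eq_imp_powr[of x d "- real_of_int k"] v.pos[OF x False] dk by simp
    then show ?thesis using W.abs_val_eq[OF _ False dk] x KQ by auto
  qed (simp add: W.abs_val_0)
  have "place_over Qbar p W.abs_val"
    unfolding place_over_def
  proof (intro conjI ballI allI impI)
    show "W.abs_val x = 0" if "x \<notin> Qbar" for x using that by (simp add: W.abs_val_def)
    show "0 \<le> W.abs_val x" for x by (rule W.abs_val_nonneg)
    show "W.abs_val x = 0 \<longleftrightarrow> x = 0" if "x \<in> Qbar" for x
      using that v.p_gt_1 by (auto simp: W.abs_val_def)
    show "W.abs_val (of_rat r) = padic_abs p r" for r
      using agree[OF sf_of_rat[OF v.subfield]] v.of_rat by simp
  qed (simp_all add: W.abs_val_mult W.abs_val_triangle)
  then show ?thesis using agree by (auto simp: divides_place_def)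
qed

section \<open>Independence and finiteness of places\<close>

lemma place_I: "number_field K \<Longrightarrow> prime p \<Longrightarrow> place_over K p v \<Longrightarrow> place K p v"
  by (simp add: place_def number_field_subfield)

text \<open>A rational b/a strictly between the base-p logarithms of v y and w y gives z = y^a p^b:
  v and w agree on p, so the factor p^b shifts both logarithms equally and brings 0 between
  them.\<close>

lemma separating_element:
  assumes "place K p v" "place K p w" "v \<noteq> w"
  shows "\<exists>z\<in>K. v z < 1 \<and> 1 < w z"
proof -
  interpret v: place K p v by fact
  interpret w: place K p w by fact
  obtain x where x: "v x \<noteq> w x" using assms(3) by auto
  then have xK: "x \<in> K" "x \<noteq> 0" using v.out w.out v.zero w.zero by metis+
  obtain y where y: "y \<in> K" "y \<noteq> 0" "v y < w y"
  proof (cases "v x < w x")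
    case False
    then have "inverse (v x) < inverse (w x)"
      using x xK w.pos by (intro less_imp_inverse_less) auto
    then show ?thesis using that[of "inverse x"] xK sf_inverse[OF v.subfield] v.inverse w.inverse by simp
  qed (use that xK in blast)
  have pos: "v y > 0" "w y > 0" using y v.pos w.pos by auto
  have "ln (v y) / ln p < ln (w y) / ln p"
    using y pos v.p_gt_1 by (intro divide_strict_right_mono) auto
  then obtain r :: rat where r: "ln (v y) / ln p < of_rat r" "of_rat r < ln (w y) / ln p"
    using of_rat_dense by blast
  obtain b a where ba: "r = Rat.Fract b a" "a > 0" by (cases r)
  have r_eq: "(of_rat r :: real) = of_int b / of_int a" using ba by (simp add: of_rat_rat)
  have "real_of_int a > 0" using ba by simp
  have lv: "real_of_int a * ln (v y) < real_of_int b * ln p"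
    using r(1) \<open>real_of_int a > 0\<close> v.p_gt_1 unfolding r_eq by (simp add: field_simps)
  have lw: "real_of_int b * ln p < real_of_int a * ln (w y)"
    using r(2) \<open>real_of_int a > 0\<close> v.p_gt_1 unfolding r_eq by (simp add: field_simps)
  define z where "z = y ^ nat a * of_nat p powi b"
  have z: "z \<in> K"
    unfolding z_def by (intro sf_mult[OF v.subfield] sf_power[OF v.subfield] sf_power_int[OF v.subfield] y v.p_in)
  have ln_eq: "ln (u z) = real_of_int a * ln (u y) - real_of_int b * ln p" "u z > 0"
    if "place K p u" for u
  proof -
    interpret u: place K p u by fact
    have uz: "u z = u y ^ nat a * real p powr (- real_of_int b)"
      using y unfolding z_def
      by (simp add: u.mult u.power u.of_nat_p_powi sf_power[OF u.subfield] sf_power_int[OF u.subfield] u.p_in)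
    have "u y > 0" using u.pos y by auto
    then show "u z > 0" using uz u.p_gt_1 by simp
    show "ln (u z) = real_of_int a * ln (u y) - real_of_int b * ln p"
      using \<open>u y > 0\<close> u.p_gt_1 ba unfolding uz by (simp add: ln_mult ln_realpow ln_powr)
  qed
  have "ln (v z) < 0" "ln (w z) > 0" using ln_eq(1)[OF assms(1)] ln_eq(1)[OF assms(2)] lv lw by auto
  then show ?thesis using z ln_eq(2)[OF assms(1)] ln_eq(2)[OF assms(2)] by (intro bexI[of _ z]) auto
qed

lemma eventually_power_mult_less_one:
  fixes c d :: real
  assumes "0 \<le> c" "c < 1"
  shows "eventually (\<lambda>k. c ^ k * d < 1) sequentially"
proof -
  have "(\<lambda>k. c ^ k * d) \<longlonglongrightarrow> 0 * d" using assms by (intro tendsto_mult LIMSEQ_power_zero tendsto_const) auto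
  then show ?thesis by (intro order_tendstoD(2)) auto
qed

text \<open>Induction on J, with x good for the old places and y separating w from v. If w x = 1,
  then x^k y works for large k. If w x > 1, the factor x^k / (1 + x^k) has value exactly 1 at v and
  w by the ultrametric inequality and becomes small on J.\<close>

lemma weak_approximation:
  assumes "finite J" "\<forall>w\<in>J. place K p w" "place K p v" "v \<notin> J"
  shows "\<exists>x\<in>K. 1 < v x \<and> (\<forall>w\<in>J. w x < 1)"
  using assms(1,2,4)
proof induction
  interpret v: place K p v by fact
  case empty
  have "v (inverse (of_nat p)) = real p" by (simp add: v.inverse v.p_in v.of_nat_p)
  then show ?case using v.p_gt_1 sf_inverse[OF v.subfield v.p_in] by (intro bexI[of _ "inverse (of_nat p)"]) auto
next
  interpret v: place K p v by fact
  note [intro] = sf_mult[OF v.subfield] sf_divide[OF v.subfield] sf_add[OF v.subfield]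
    sf_power[OF v.subfield] sf_1[OF v.subfield]
  case (insert w J)
  then obtain x where x: "x \<in> K" "1 < v x" "\<forall>u\<in>J. u x < 1" by auto
  have w: "place K p w" using insert by auto
  interpret w: place K p w by fact
  obtain y where y: "y \<in> K" "w y < 1" "1 < v y"
    using separating_element[OF w assms(3)] insert by auto
  have ev: "eventually (\<lambda>k. \<forall>u\<in>J. u x ^ k * u y < 1) sequentially"
    using x insert by (intro eventually_ball_finite ballI eventually_power_mult_less_one)
      (auto simp: place.nonneg)
  obtain k where k: "k > 0" "\<forall>u\<in>J. u x ^ k * u y < 1"
    using eventually_conj[OF eventually_gt_at_top[of 0] ev] by (auto dest: eventually_happens)
  have big: "u (x ^ k / (1 + x ^ k)) = 1" if "u x > 1" "place K p u" for u
  proof -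
    interpret u: place K p u by fact
    have "u (x ^ k) > 1" using that k x by (simp add: u.power one_less_power)
    then have "u (1 + x ^ k) = u (x ^ k)" using u.ultrametric_strict[of 1 "x ^ k"] x by auto
    then show ?thesis using x \<open>u (x ^ k) > 1\<close> by (subst u.divide) auto
  qed
  consider "w x < 1" | "w x = 1" | "w x > 1" by linarith
  then show ?case
  proof cases
    case 1
    then show ?thesis using x by auto
  next
    case 2
    have "v (x ^ k * y) > 1"
      using x y k by (subst v.mult) (auto simp: v.power intro!: less_1_mult one_less_power)
    moreover have "w (x ^ k * y) < 1" using 2 x y by (subst w.mult) (auto simp: w.power)
    moreover have "u (x ^ k * y) < 1" if "u \<in> J" for u
    proof -
      interpret u: place K p u using insert that by auto
      show ?thesis using that k x y by (subst u.mult) (auto simp: u.power)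
    qed
    ultimately show ?thesis using x y by (intro bexI[of _ "x ^ k * y"]) auto
  next
    case 3
    let ?z = "x ^ k / (1 + x ^ k) * y"
    have "v ?z > 1" using x y big[OF x(2) assms(3)] by (subst v.mult) auto
    moreover have "w ?z < 1" using x y big[OF 3 w] by (subst w.mult) auto
    moreover have "u ?z < 1" if "u \<in> J" for u
    proof -
      interpret u: place K p u using insert that by auto
      have "u (x ^ k) < 1"
        using x k that by (simp add: u.power power_Suc_less_one[of "u x" "k - 1"] power_less_one_iff)
      then have "u (x ^ k + 1) = 1" using u.ultrametric_strict[of "x ^ k" 1] x by auto
      then have "u (x ^ k / (1 + x ^ k)) = u x ^ k"
        using x by (subst u.divide) (auto simp: add.commute u.power)
      then show ?thesis using that k x y by (subst u.mult) auto
    qed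
    ultimately show ?thesis using x y by (intro bexI[of _ ?z]) auto
  qed
qed

text \<open>Elements that are large at one place of G and small at the others are independent over
  the rationals: in a relation, the term whose coefficient is p-adically largest exceeds all other
  terms at its own place. So G has at most \<open>card B\<close> members.\<close>

lemma finite_places_over:
  assumes K: "number_field K" and p: "prime p"
  shows "finite {v. place_over K p v}"
proof -
  obtain B where B: "finite B" "K = Q.span B" using K by (auto simp: number_field_iff)
  have "card G \<le> card B" if G: "G \<subseteq> {v. place_over K p v}" "finite G" for G
  proof -
    have pl: "place K p v" if "v \<in> G" for v using that G p K place_I by auto
    have "\<exists>x\<in>K. 1 < v x \<and> (\<forall>w\<in>G - {v}. w x < 1)" if "v \<in> G" for v
      using weak_approximation[of "G - {v}" K p v] G pl that by auto
    then obtain x where x: "\<And>v. v \<in> G \<Longrightarrow> x v \<in> K" "\<And>v. v \<in> G \<Longrightarrow> 1 < v (x v)"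
      "\<And>v w. v \<in> G \<Longrightarrow> w \<in> G \<Longrightarrow> w \<noteq> v \<Longrightarrow> w (x v) < 1"
      by (metis DiffI empty_iff insert_iff)
    have inj: "inj_on x G"
    proof (rule inj_onI, rule ccontr)
      fix v w assume "v \<in> G" "w \<in> G" "x v = x w" "v \<noteq> w"
      then show False using x(2)[of v] x(3)[of w v] by simp
    qed
    have "Q.independent (x ` G)"
    proof
      assume "Q.dependent (x ` G)"
      then obtain u where u: "\<exists>z\<in>x ` G. u z \<noteq> 0" "(\<Sum>z\<in>x ` G. of_rat (u z) * z) = 0"
        using G by (subst (asm) Q.dependent_finite) auto
      define q where "q v = u (x v)" for v
      have q0: "(\<Sum>v\<in>G. of_rat (q v) * x v) = 0"
        using u(2) by (simp add: sum.reindex[OF inj] q_def)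
      obtain v0 where v0: "v0 \<in> G" "q v0 \<noteq> 0" using u(1) by (auto simp: q_def)
      define M where "M = Max ((\<lambda>v. padic_abs p (q v)) ` G)"
      have "M \<in> (\<lambda>v. padic_abs p (q v)) ` G" using v0 G unfolding M_def by (intro Max_in) auto
      then obtain v where v: "v \<in> G" "padic_abs p (q v) = M" by auto
      interpret v: place K p v using pl v by auto
      have le: "padic_abs p (q w) \<le> M" if "w \<in> G" for w using that G by (simp add: M_def)
      have "v (of_rat (q v0)) > 0" using v0 by (intro v.pos sf_of_rat[OF v.subfield]) auto
      then have M0: "M > 0" using le[OF v0(1)] v.of_rat by simp
      have "v (\<Sum>w\<in>G - {v}. of_rat (q w) * x w) \<le> M"
      proof (rule v.ultrametric_sum)
        fix w assume w: "w \<in> G - {v}"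
        then show "of_rat (q w) * x w \<in> K" using x sf_mult[OF v.subfield sf_of_rat[OF v.subfield]] by auto
        have "v (of_rat (q w) * x w) = padic_abs p (q w) * v (x w)"
          using w x v.of_rat sf_of_rat[OF v.subfield] by (subst v.mult) auto
        also have "\<dots> \<le> M * 1" using w x(3)[of w v] v le M0 by (intro mult_mono) auto
        finally show "v (of_rat (q w) * x w) \<le> M" by simp
      qed (use M0 in auto)
      moreover have "(\<Sum>w\<in>G - {v}. of_rat (q w) * x w) = - (of_rat (q v) * x v)"
        using q0 sum.remove[OF G(2) v(1), of "\<lambda>v. of_rat (q v) * x v"] by (simp add: eq_neg_iff_add_eq_0 add.commute)
      moreover have "v (of_rat (q v) * x v) = M * v (x v)"
        using v x v.of_rat sf_of_rat[OF v.subfield] by (subst v.mult) auto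
      ultimately show False using x(2)[OF v(1)] M0 by (simp add: v.minus)
    qed
    moreover have "x ` G \<subseteq> Q.span B" using x B by auto
    ultimately show ?thesis using Q.independent_span_bound[OF B(1)] card_image[OF inj] by metis
  qed
  then show ?thesis using finite_if_finite_subsets_card_bdd[of "{v. place_over K p v}" "card B"] by blast
qed

section \<open>The functional\<close>

text \<open>The value 0 outside K is the one prescribed by \<open>place_over\<close>, so the place
  of K below w is literally this function.\<close>

definition restrict_place :: "complex set \<Rightarrow> (complex \<Rightarrow> real) \<Rightarrow> complex \<Rightarrow> real" where
  "restrict_place K w = (\<lambda>x. if x \<in> K then w x else 0)"

lemma divides_restrict_place: "divides_place K w (restrict_place K w)"
  by (simp add: divides_place_def restrict_place_def)

lemma place_over_restrict:
  assumes "number_field K" "K \<subseteq> L" "place_over L p w"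
  shows "place_over K p (restrict_place K w)"
  using assms(2,3) number_field_subfield[OF assms(1)]
  by (auto simp: place_over_def restrict_place_def sf_of_rat sf_mult sf_add subset_iff)

lemma places_S_restrict:
  "number_field K \<Longrightarrow> K \<subseteq> L \<Longrightarrow> w \<in> places_S S L \<Longrightarrow> restrict_place K w \<in> places_S S K"
  unfolding places_S_def using place_over_restrict by blast

lemma divides_place_eq:
  assumes "v \<in> places_S S K"
  shows "divides_place K w v \<longleftrightarrow> v = restrict_place K w"
  using assms by (auto simp: divides_place_def restrict_place_def places_S_def place_over_def fun_eq_iff)

text \<open>The integer p has value 1/p at a place above p and value 1 at a place above any other
  prime.\<close>

lemma same_prime:
  assumes K: "complex_subfield K" and L: "complex_subfield L" and pq: "prime p" "prime q"
    and v: "place_over K p v" and w: "place_over L q w" and dvd: "divides_place K w v"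
  shows "p = q"
proof (rule ccontr)
  assume "p \<noteq> q"
  interpret v: place K p v using assms by unfold_locales
  interpret w: place L q w using assms by unfold_locales
  have "\<not> int q dvd int p" using \<open>p \<noteq> q\<close> pq primes_dvd_imp_eq by (simp, blast)
  then have "w (of_nat p) = 1" using w.of_int_eq_1[of "int p"] by simp
  then show False using dvd v.p_in v.of_nat_p v.p_gt_1 by (auto simp: divides_place_def)
qed

text \<open>The condition inside the choice in \<open>Phi\<close>, isolated so that competing pairs
  (K, g) can be compared.\<close>

definition locally_constant_via ::
  "nat set \<Rightarrow> ((complex \<Rightarrow> real) \<Rightarrow> real) \<Rightarrow> complex set \<Rightarrow> ((complex \<Rightarrow> real) \<Rightarrow> real) \<Rightarrow> bool" where
  "locally_constant_via S f K g \<longleftrightarrow> number_field K \<and>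
     (\<forall>v \<in> places_S S K. \<forall>y \<in> X_places S. divides_place K y v \<longrightarrow> f y = g v) \<and>
     finite {v \<in> places_S S K. g v \<noteq> 0}"

context
  fixes S c
  assumes primes: "\<forall>p\<in>S. prime p" and cons: "consistent S c"
begin

text \<open>Places of L above v lie over the same prime as v, of which there are finitely
  many.\<close>

lemma finite_places_above:
  assumes K: "number_field K" and L: "number_field L" and v: "v \<in> places_S S K"
  shows "finite {w \<in> places_S S L. divides_place K w v}"
proof -
  obtain p where p: "p \<in> S" "place_over K p v" using v by (auto simp: places_S_def)
  have "{w \<in> places_S S L. divides_place K w v} \<subseteq> {w. place_over L p w}"
  proof
    fix w assume w: "w \<in> {w \<in> places_S S L. divides_place K w v}"
    then obtain q where "q \<in> S" "place_over L q w" by (auto simp: places_S_def)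
    then show "w \<in> {w. place_over L p w}"
      using same_prime[OF number_field_subfield[OF K] number_field_subfield[OF L] _ _ p(2), of q w] w p primes
      by auto
  qed
  then show ?thesis using finite_places_over[OF L, of p] p primes finite_subset by blast
qed

text \<open>Places of L are grouped by their restriction to K; the transported function is constant
  on each group, and consistency adds the c-values of the group up to c K v.\<close>

lemma Phi_sum_extend:
  assumes f: "locally_constant_via S f K g" and L: "number_field L" "K \<subseteq> L"
  shows "locally_constant_via S f L (\<lambda>w. g (restrict_place K w))"
    and "(\<Sum>w \<in> {w \<in> places_S S L. g (restrict_place K w) \<noteq> 0}. c L w * g (restrict_place K w)) =
         (\<Sum>v \<in> {v \<in> places_S S K. g v \<noteq> 0}. c K v * g v)"
proof -
  have K: "number_field K" using f by (simp add: locally_constant_via_def)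
  define V where "V = {v \<in> places_S S K. g v \<noteq> 0}"
  define W where "W = {w \<in> places_S S L. g (restrict_place K w) \<noteq> 0}"
  define above where "above v = {w \<in> places_S S L. divides_place K w v}" for v
  have fin_V: "finite V" using f by (simp add: locally_constant_via_def V_def)
  have fin_above: "finite (above v)" if "v \<in> V" for v
    using that finite_places_above[OF K L(1)] by (auto simp: above_def V_def)
  have W_eq: "W = (\<Union>v\<in>V. above v)"
  proof (intro equalityI subsetI)
    fix w assume w: "w \<in> W"
    then have "restrict_place K w \<in> V" "w \<in> above (restrict_place K w)"
      using places_S_restrict[OF K L(2), of w S] by (auto simp: W_def V_def above_def divides_restrict_place)
    then show "w \<in> (\<Union>v\<in>V. above v)" by blast
  qed (auto simp: W_def V_def above_def divides_place_eq)
  have fin_W: "finite W" unfolding W_eq using fin_V fin_above by auto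
  show "locally_constant_via S f L (\<lambda>w. g (restrict_place K w))"
    unfolding locally_constant_via_def
  proof (intro conjI ballI impI)
    fix w y assume w: "w \<in> places_S S L" and y: "y \<in> X_places S" "divides_place L y w"
    have "divides_place K y (restrict_place K w)"
      using y L by (auto simp: divides_place_def restrict_place_def)
    then show "f y = g (restrict_place K w)"
      using f y places_S_restrict[OF K L(2) w] by (auto simp: locally_constant_via_def)
  qed (use L fin_W in \<open>auto simp: W_def\<close>)
  have "(\<Sum>w\<in>W. c L w * g (restrict_place K w)) = (\<Sum>v\<in>V. \<Sum>w\<in>above v. c L w * g (restrict_place K w))"
    unfolding W_eq
  proof (rule sum.UNION_disjoint)
    show "\<forall>v\<in>V. \<forall>v'\<in>V. v \<noteq> v' \<longrightarrow> above v \<inter> above v' = {}"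
      by (auto simp: above_def V_def divides_place_eq)
  qed (use fin_V fin_above in auto)
  also have "\<dots> = (\<Sum>v\<in>V. c K v * g v)"
  proof (rule sum.cong[OF refl])
    fix v assume v: "v \<in> V"
    then have vS: "v \<in> places_S S K" by (simp add: V_def)
    have "(\<Sum>w\<in>above v. c L w * g (restrict_place K w)) = (\<Sum>w\<in>above v. c L w * g v)"
      using vS by (intro sum.cong) (auto simp: above_def divides_place_eq)
    also have "\<dots> = (\<Sum>w\<in>above v. c L w) * g v" by (simp add: sum_distrib_right)
    also have "(\<Sum>w\<in>above v. c L w) = c K v"
      using cons K L vS by (auto simp: consistent_def J_set_def above_def)
    finally show "(\<Sum>w\<in>above v. c L w * g (restrict_place K w)) = c K v * g v" .
  qed
  finally show "(\<Sum>w \<in> {w \<in> places_S S L. g (restrict_place K w) \<noteq> 0}. c L w * g (restrict_place K w)) =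
         (\<Sum>v \<in> {v \<in> places_S S K. g v \<noteq> 0}. c K v * g v)"
    by (simp add: W_def V_def)
qed

text \<open>Both values equal f y for a place y of \<open>Qbar\<close> above w, which exists by
  \<open>place_extends_to_Qbar\<close>.\<close>

lemma locally_constant_values_unique:
  assumes "locally_constant_via S f L g" "locally_constant_via S f L g'" "w \<in> places_S S L"
  shows "g w = g' w"
proof -
  obtain p where p: "p \<in> S" "place_over L p w" using assms by (auto simp: places_S_def)
  then obtain y where "place_over Qbar p y" "divides_place L y w"
    using place_extends_to_Qbar[of L p w] primes assms by (auto simp: locally_constant_via_def)
  then have "y \<in> X_places S" "divides_place L y w" using p by (auto simp: X_places_def places_S_def)
  then show ?thesis using assms by (auto simp: locally_constant_via_def)
qed

text \<open>Two competing pairs are transported to a common number field, where their functions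
  coincide on all places; so the choice in \<open>Phi\<close> has a single candidate.\<close>

lemma Phi_eq:
  assumes f: "locally_constant_via S f K g"
  shows "Phi S c f = (\<Sum>v \<in> {v \<in> places_S S K. g v \<noteq> 0}. c K v * g v)"
proof -
  have unique: "(\<Sum>v \<in> {v \<in> places_S S K'. g' v \<noteq> 0}. c K' v * g' v) =
      (\<Sum>v \<in> {v \<in> places_S S K. g v \<noteq> 0}. c K v * g v)" if f': "locally_constant_via S f K' g'" for K' g'
  proof -
    obtain L where L: "number_field L" "K \<subseteq> L" "K' \<subseteq> L"
      using number_field_compositum[of K K'] f f' by (auto simp: locally_constant_via_def)
    have eq: "g (restrict_place K w) = g' (restrict_place K' w)" if "w \<in> places_S S L" for w
      using locally_constant_values_unique[OF Phi_sum_extend(1)[OF f L(1,2)] Phi_sum_extend(1)[OF f' L(1,3)] that]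
      by simp
    have "(\<Sum>w \<in> {w \<in> places_S S L. g (restrict_place K w) \<noteq> 0}. c L w * g (restrict_place K w)) =
          (\<Sum>w \<in> {w \<in> places_S S L. g' (restrict_place K' w) \<noteq> 0}. c L w * g' (restrict_place K' w))"
      using eq by (intro sum.cong) auto
    then show ?thesis
      unfolding Phi_sum_extend(2)[OF f L(1,2)] Phi_sum_extend(2)[OF f' L(1,3)] by simp
  qed
  show ?thesis
    unfolding Phi_def
  proof (rule some_equality)
    show "\<exists>K' g'. number_field K' \<and>
       (\<forall>v \<in> places_S S K'. \<forall>y \<in> X_places S. divides_place K' y v \<longrightarrow> f y = g' v) \<and>
       finite {v \<in> places_S S K'. g' v \<noteq> 0} \<and>
       (\<Sum>v \<in> {v \<in> places_S S K. g v \<noteq> 0}. c K v * g v) =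
       (\<Sum>v \<in> {v \<in> places_S S K'. g' v \<noteq> 0}. c K' v * g' v)"
      using f unfolding locally_constant_via_def by blast
  next
    fix r assume "\<exists>K' g'. number_field K' \<and>
       (\<forall>v \<in> places_S S K'. \<forall>y \<in> X_places S. divides_place K' y v \<longrightarrow> f y = g' v) \<and>
       finite {v \<in> places_S S K'. g' v \<noteq> 0} \<and>
       r = (\<Sum>v \<in> {v \<in> places_S S K'. g' v \<noteq> 0}. c K' v * g' v)"
    then show "r = (\<Sum>v \<in> {v \<in> places_S S K. g v \<noteq> 0}. c K v * g v)"
      using unique unfolding locally_constant_via_def by blast
  qed
qed

lemma Phi_f_alpha:
  assumes K: "number_field K" and "\<alpha> \<in> K" and fin: "finite {v \<in> places_S S K. ln (v \<alpha>) \<noteq> 0}"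
  shows "Phi S c (f_alpha \<alpha>) = (\<Sum>v \<in> {v \<in> places_S S K. ln (v \<alpha>) \<noteq> 0}. c K v * ln (v \<alpha>))"
  using assms by (intro Phi_eq) (auto simp: locally_constant_via_def f_alpha_def divides_place_def)

end

section \<open>Lattices and the norm\<close>

text \<open>\<open>mult_int\<close> makes the lattice spanned by b closed under multiplication,
  though it need not contain 1. Any basis can be rescaled to this form.\<close>

locale lattice_basis =
  fixes K :: "complex set" and n :: nat and b :: "nat \<Rightarrow> complex" and co :: "complex \<Rightarrow> nat \<Rightarrow> rat"
  assumes nf: "number_field K"
    and b_in: "i < n \<Longrightarrow> b i \<in> K"
    and co_sum: "x \<in> K \<Longrightarrow> (\<Sum>i<n. of_rat (co x i) * b i) = x"
    and co_unique: "i < n \<Longrightarrow> co (\<Sum>j<n. of_rat (q j) * b j) i = q i"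
    and mult_int: "i < n \<Longrightarrow> j < n \<Longrightarrow> k < n \<Longrightarrow> co (b i * b j) k \<in> \<int>"

lemma lattice_basis_exists:
  assumes K: "number_field K"
  shows "\<exists>n b co. lattice_basis K n b co"
proof -
  note sK = number_field_subfield[OF K]
  obtain B where B: "finite B" "K = Q.span B" using K by (auto simp: number_field_iff)
  obtain C where C: "C \<subseteq> B" "Q.independent C" "B \<subseteq> Q.span C"
    using Q.maximal_independent_subset by blast
  have fC: "finite C" using B C finite_subset by blast
  have KC: "K = Q.span C" using B C Q.span_eq Q.span_superset by blast
  define n where "n = card C"
  obtain e where e: "bij_betw e {..<n} C"
    using ex_bij_betw_nat_finite[OF fC] by (auto simp: n_def atLeast0LessThan)
  have eC: "e i \<in> C" if "i < n" for i using e that by (auto simp: bij_betw_def)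
  have eK: "e i \<in> K" if "i < n" for i using eC[OF that] KC Q.span_superset by auto
  define r where "r x i = Q.representation C x (e i)" for x i
  have r_sum: "(\<Sum>i<n. of_rat (r x i) * e i) = x" if "x \<in> K" for x
  proof -
    have "(\<Sum>i<n. of_rat (r x i) * e i) = (\<Sum>c\<in>C. of_rat (Q.representation C x c) * c)"
      unfolding r_def using e by (rule sum.reindex_bij_betw)
    also have "\<dots> = x" using Q.sum_representation_eq[OF C(2) _ fC order_refl] that KC by simp
    finally show ?thesis .
  qed
  have r_unique: "r (\<Sum>j<n. of_rat (q j) * e j) i = q i" if i: "i < n" for q i
  proof -
    have "r (\<Sum>j<n. of_rat (q j) * e j) i = (\<Sum>j<n. Q.representation C (of_rat (q j) * e j) (e i))"
      unfolding r_def using Q.representation_sum[OF C(2), of "{..<n}" "\<lambda>j. of_rat (q j) * e j"]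
      by (simp add: Q.span_scale Q.span_base eC)
    also have "\<dots> = (\<Sum>j<n. q j * (if e i = e j then 1 else 0))"
    proof (intro sum.cong refl)
      fix j assume "j \<in> {..<n}"
      then show "Q.representation C (of_rat (q j) * e j) (e i) = q j * (if e i = e j then 1 else 0)"
        using Q.representation_scale[OF C(2) Q.span_base[OF eC], of j "q j"]
          Q.representation_basis[OF C(2) eC, of j] by simp
    qed
    also have "\<dots> = (\<Sum>j<n. if j = i then q j else 0)"
      using e i by (intro sum.cong) (auto simp: bij_betw_def inj_on_def)
    also have "\<dots> = q i" using i by simp
    finally show ?thesis .
  qed
  \<comment> \<open>With b = D e the product b_i b_j is D^2 e_i e_j: one factor D clears the
    denominators, the other is absorbed in passing from e to b.\<close>
  obtain D :: int where D: "D > 0"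
    "\<forall>(i, j, k) \<in> {..<n} \<times> {..<n} \<times> {..<n}. of_int D * r (e i * e j) k \<in> \<int>"
    using common_denominator[of "{..<n} \<times> {..<n} \<times> {..<n}" "\<lambda>(i, j, k). r (e i * e j) k"]
    by (auto simp: case_prod_unfold)
  define b where "b i = of_int D * e i" for i
  define co where "co x i = r x i / of_int D" for x i
  have scale: "of_rat q * e i = of_rat (q / of_int D) * b i" for q i
    using D by (simp add: b_def of_rat_divide)
  have scale': "of_rat q * b i = of_rat (q * of_int D) * e i" for q i
    by (simp add: b_def of_rat_mult)
  have "lattice_basis K n b co"
  proof
    show "number_field K" by fact
    show "b i \<in> K" if "i < n" for i
      using eK[OF that] by (simp add: b_def sf_mult[OF sK] sf_of_int[OF sK])
    show "(\<Sum>i<n. of_rat (co x i) * b i) = x" if "x \<in> K" for x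
      using r_sum[OF that] by (simp add: co_def scale)
    show co_unique: "co (\<Sum>j<n. of_rat (q j) * b j) i = q i" if "i < n" for i q
      unfolding scale' co_def r_unique[OF that] using D by simp
    show "co (b i * b j) k \<in> \<int>" if "i < n" "j < n" "k < n" for i j k
    proof -
      have "e i * e j \<in> K" using that eK sf_mult[OF sK] by blast
      then have "b i * b j = of_int (D * D) * (\<Sum>l<n. of_rat (r (e i * e j) l) * e l)"
        using r_sum by (simp add: b_def)
      also have "\<dots> = (\<Sum>l<n. of_rat (of_int D * r (e i * e j) l) * b l)"
        unfolding sum_distrib_left by (intro sum.cong) (auto simp: b_def of_rat_mult mult_ac)
      finally show ?thesis using co_unique[OF that(3)] D that by simp
    qed
  qed
  then show ?thesis by blast
qed

context lattice_basis
begin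

lemma sK: "complex_subfield K" using nf by (rule number_field_subfield)

lemma co_lincomb:
  assumes "\<And>l. l \<in> I \<Longrightarrow> y l \<in> K" "i < n"
  shows "co (\<Sum>l\<in>I. of_rat (q l) * y l) i = (\<Sum>l\<in>I. q l * co (y l) i)"
proof -
  have "(\<Sum>l\<in>I. of_rat (q l) * y l) = (\<Sum>l\<in>I. of_rat (q l) * (\<Sum>j<n. of_rat (co (y l) j) * b j))"
    using assms by (intro sum.cong) (auto simp: co_sum)
  also have "\<dots> = (\<Sum>l\<in>I. \<Sum>j<n. of_rat (q l * co (y l) j) * b j)"
    unfolding sum_distrib_left by (intro sum.cong refl) (simp add: of_rat_mult mult_ac)
  also have "\<dots> = (\<Sum>j<n. \<Sum>l\<in>I. of_rat (q l * co (y l) j) * b j)" by (rule sum.swap)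
  also have "\<dots> = (\<Sum>j<n. of_rat (\<Sum>l\<in>I. q l * co (y l) j) * b j)"
    by (simp add: of_rat_sum sum_distrib_right)
  finally show ?thesis using co_unique[OF assms(2)] by simp
qed

lemma co_scale: "x \<in> K \<Longrightarrow> i < n \<Longrightarrow> co (of_rat q * x) i = q * co x i"
  using co_lincomb[of "{()}" "\<lambda>_. x" i "\<lambda>_. q"] by simp

lemma co_scale_int: "x \<in> K \<Longrightarrow> i < n \<Longrightarrow> co (of_int m * x) i = of_int m * co x i"
  using co_scale[of x i "of_int m"] by simp

lemma co_add: "x \<in> K \<Longrightarrow> y \<in> K \<Longrightarrow> i < n \<Longrightarrow> co (x + y) i = co x i + co y i"
  using co_lincomb[of "{True, False}" "\<lambda>t. if t then x else y" i "\<lambda>_. 1"] by simp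

lemma co_diff: "x \<in> K \<Longrightarrow> y \<in> K \<Longrightarrow> i < n \<Longrightarrow> co (x - y) i = co x i - co y i"
  using co_lincomb[of "{True, False}" "\<lambda>t. if t then x else y" i "\<lambda>t. if t then 1 else - 1"]
  by (simp add: of_rat_minus)

lemma co_mult:
  assumes "x \<in> K" "y \<in> K" "i < n"
  shows "co (x * y) i = (\<Sum>k<n. co y k * co (x * b k) i)"
proof -
  have "x * y = x * (\<Sum>k<n. of_rat (co y k) * b k)" using assms by (simp add: co_sum)
  also have "\<dots> = (\<Sum>k<n. of_rat (co y k) * (x * b k))"
    unfolding sum_distrib_left by (intro sum.cong) auto
  finally show ?thesis
    using assms b_in sf_mult[OF sK] co_lincomb[of "{..<n}" "\<lambda>k. x * b k" i "co y"] by simp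
qed

lemma n_pos: "n > 0"
proof (rule ccontr)
  assume "\<not> n > 0"
  then show False using co_sum[OF sf_1[OF sK]] by simp
qed

definition int_lattice :: "complex set" where
  "int_lattice = {x \<in> K. \<forall>i<n. co x i \<in> \<int>}"

lemma lattice_in: "x \<in> int_lattice \<Longrightarrow> x \<in> K" by (simp add: int_lattice_def)

lemma lattice_add: "x \<in> int_lattice \<Longrightarrow> y \<in> int_lattice \<Longrightarrow> x + y \<in> int_lattice"
  by (auto simp: int_lattice_def co_add sf_add[OF sK])

lemma lattice_scale: "x \<in> int_lattice \<Longrightarrow> of_int m * x \<in> int_lattice"
  by (auto simp: int_lattice_def co_scale_int sf_mult[OF sK] sf_of_int[OF sK])

lemma lattice_0: "0 \<in> int_lattice"
proof -
  have "b 0 \<in> K" using b_in n_pos by auto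
  then show ?thesis using co_scale_int[of "b 0" _ 0] by (auto simp: int_lattice_def sf_0[OF sK])
qed

lemma lattice_sum: "(\<And>i. i \<in> I \<Longrightarrow> f i \<in> int_lattice) \<Longrightarrow> sum f I \<in> int_lattice"
  by (induction I rule: infinite_finite_induct) (auto simp: lattice_0 lattice_add)

lemma lattice_mult:
  assumes "x \<in> int_lattice" "y \<in> int_lattice"
  shows "x * y \<in> int_lattice"
proof -
  have xy: "x \<in> K" "y \<in> K" using assms by (auto simp: lattice_in)
  have "co (x * y) i \<in> \<int>" if i: "i < n" for i
  proof -
    have "co (x * y) i = (\<Sum>k<n. co y k * (\<Sum>j<n. co x j * co (b k * b j) i))"
      using xy b_in co_mult[OF b_in xy(1) i] by (subst co_mult[OF xy i]) (simp add: mult.commute)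
    then show ?thesis using assms i mult_int by (auto simp: int_lattice_def intro!: Ints_sum Ints_mult)
  qed
  then show ?thesis using xy sf_mult[OF sK] by (simp add: int_lattice_def)
qed

lemma lattice_power: "k > 0 \<Longrightarrow> x \<in> int_lattice \<Longrightarrow> x ^ k \<in> int_lattice"
  by (induction k rule: nat_induct_non_zero) (auto intro: lattice_mult)

lemma lattice_multiple:
  assumes "x \<in> K"
  obtains D :: int where "D > 0" "of_int D * x \<in> int_lattice"
proof -
  obtain D :: int where "D > 0" "\<forall>i\<in>{..<n}. of_int D * co x i \<in> \<int>"
    using common_denominator[of "{..<n}" "co x"] by auto
  then show ?thesis using that assms sf_mult[OF sK sf_of_int[OF sK]]
    by (auto simp: int_lattice_def co_scale_int)
qed

lemma lattice_common_multiple: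
  assumes "finite I" "\<And>i. i \<in> I \<Longrightarrow> f i \<in> K"
  shows "\<exists>D::int. D > 0 \<and> (\<forall>i\<in>I. of_int D * f i \<in> int_lattice)"
  using assms
proof induction
  case empty
  show ?case by (intro exI[of _ 1]) auto
next
  case (insert j I)
  then obtain D :: int where D: "D > 0" "\<forall>i\<in>I. of_int D * f i \<in> int_lattice" by auto
  obtain E :: int where E: "E > 0" "of_int E * f j \<in> int_lattice" using insert lattice_multiple by blast
  have "of_int (D * E) * f i \<in> int_lattice" if "i \<in> insert j I" for i
    using that D(2) E(2) lattice_scale[of "of_int D * f i" E] lattice_scale[of "of_int E * f j" D]
    by (auto simp: mult_ac)
  then show ?case using D E by (intro exI[of _ "D * E"]) auto
qed

definition mult_mat :: "complex \<Rightarrow> rat mat" where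
  "mult_mat x = mat n n (\<lambda>(i, j). co (x * b j) i)"

text \<open>The field norm over the rationals. In determinant form, multiplicativity is
  \<open>det_mult\<close>, and integrality and smallness are read off the matrix entries.\<close>

definition nrm :: "complex \<Rightarrow> rat" where
  "nrm x = det (mult_mat x)"

lemma mult_mat_carrier: "mult_mat x \<in> carrier_mat n n"
  by (simp add: mult_mat_def)

lemma nrm_mult:
  assumes "x \<in> K" "y \<in> K"
  shows "nrm (x * y) = nrm x * nrm y"
proof -
  have "mult_mat (x * y) = mult_mat x * mult_mat y"
  proof (rule eq_matI)
    fix i j assume "i < dim_row (mult_mat x * mult_mat y)" "j < dim_col (mult_mat x * mult_mat y)"
    then have ij: "i < n" "j < n" by (auto simp: mult_mat_def)
    have "co (x * y * b j) i = co (x * (y * b j)) i" by (simp add: mult.assoc)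
    also have "\<dots> = (\<Sum>k<n. co (y * b j) k * co (x * b k) i)"
      using assms ij b_in sf_mult[OF sK] by (intro co_mult) auto
    finally show "mult_mat (x * y) $$ (i, j) = (mult_mat x * mult_mat y) $$ (i, j)"
      using ij by (simp add: mult_mat_def scalar_prod_def atLeast0LessThan mult.commute)
  qed (auto simp: mult_mat_def)
  then show ?thesis by (simp add: nrm_def det_mult[OF mult_mat_carrier mult_mat_carrier])
qed

lemma nrm_1: "nrm 1 = 1"
proof -
  have "co (b j) i = (if i = j then 1 else 0)" if "i < n" "j < n" for i j
  proof -
    have "(\<Sum>k<n. of_rat (if k = j then 1 else 0) * b k) = (\<Sum>k<n. if k = j then b k else 0)"
      by (intro sum.cong) auto
    also have "\<dots> = b j" using that by simp
    finally show ?thesis using co_unique[OF that(1), of "\<lambda>k. if k = j then 1 else 0"] by simp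
  qed
  then have "mult_mat 1 = 1\<^sub>m n" by (intro eq_matI) (auto simp: mult_mat_def)
  then show ?thesis by (simp add: nrm_def)
qed

lemma nrm_nonzero:
  assumes "x \<in> K" "x \<noteq> 0"
  shows "nrm x \<noteq> 0"
proof -
  have "nrm x * nrm (inverse x) = 1"
    using nrm_mult[of x "inverse x"] assms sf_inverse[OF sK] nrm_1 by simp
  then show ?thesis by auto
qed

lemma nrm_power: "x \<in> K \<Longrightarrow> nrm (x ^ k) = nrm x ^ k"
  by (induction k) (auto simp: nrm_1 nrm_mult sf_power[OF sK])

lemma nrm_sum:
  "nrm x = (\<Sum>p | p permutes {0..<n}. signof p * (\<Prod>i = 0..<n. co (x * b (p i)) i))"
proof -
  have "(\<Prod>i = 0..<n. mult_mat x $$ (i, p i)) = (\<Prod>i = 0..<n. co (x * b (p i)) i)"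
    if "p permutes {0..<n}" for p
  proof (rule prod.cong[OF refl])
    fix i assume "i \<in> {0..<n}"
    then have "i < n" "p i < n" using permutes_in_image[OF that, of i] by auto
    then show "mult_mat x $$ (i, p i) = co (x * b (p i)) i" by (simp add: mult_mat_def)
  qed
  then show ?thesis unfolding nrm_def det_def'[OF mult_mat_carrier] by (intro sum.cong) auto
qed

lemma nrm_lattice:
  assumes "x \<in> int_lattice"
  shows "nrm x \<in> \<int>"
  unfolding nrm_sum
proof (intro Ints_sum Ints_mult Ints_prod)
  fix p i assume p: "p \<in> {p. p permutes {0..<n}}" and i: "i \<in> {0..<n}"
  have pi: "p i < n" using permutes_in_image[of p "{0..<n}" i] p i by auto
  have "b (p i) \<in> int_lattice"
  proof -
    have "co (b (p i)) k \<in> \<int>" if "k < n" for k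
      using co_unique[OF that, of "\<lambda>k. if k = p i then 1 else 0"] pi
      by (simp add: if_distrib[of of_rat] if_distrib[of "\<lambda>z. z * _"] cong: if_cong)
    then show ?thesis using pi b_in by (simp add: int_lattice_def)
  qed
  then show "co (x * b (p i)) i \<in> \<int>" using lattice_mult[OF assms] i by (auto simp: int_lattice_def)
qed (auto simp: sign_def)

text \<open>The entries of \<open>mult_mat\<close> are linear in the coordinates, and the Leibniz
  sum has n! terms, each at most \<delta>^n \<le> \<delta>.\<close>

lemma nrm_small:
  obtains M :: nat where "M > 0" "\<And>x. x \<in> K \<Longrightarrow> (\<And>i. i < n \<Longrightarrow> \<bar>co x i\<bar> \<le> 1 / of_nat M) \<Longrightarrow> \<bar>nrm x\<bar> < 1"
proof -
  define C where "C = (\<Sum>i<n. \<Sum>j<n. \<Sum>k<n. \<bar>co (b k * b j) i\<bar>)"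
  have C: "(\<Sum>k<n. \<bar>co (b k * b j) i\<bar>) \<le> C" if "i < n" "j < n" for i j
  proof -
    have "(\<Sum>k<n. \<bar>co (b k * b j) i\<bar>) \<le> (\<Sum>j<n. \<Sum>k<n. \<bar>co (b k * b j) i\<bar>)"
      using that by (intro member_le_sum[of j "{..<n}"]) (auto intro: sum_nonneg)
    also have "\<dots> \<le> C" unfolding C_def
      using that by (intro member_le_sum[of i "{..<n}" "\<lambda>i. \<Sum>j<n. \<Sum>k<n. \<bar>co (b k * b j) i\<bar>"]) (auto intro!: sum_nonneg)
    finally show ?thesis .
  qed
  have C0: "C \<ge> 0" unfolding C_def by (intro sum_nonneg) auto
  \<comment> \<open>This M gives \<delta> = C / M both \<delta> \<le> 1 and n! \<delta> < 1; the
    summand 1 keeps M positive when C = 0.\<close>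
  obtain M where M: "(C + 1) * fact n < of_nat M" using reals_Archimedean2 by blast
  have f1: "(fact n :: rat) \<ge> 1" by simp
  have "0 < (C + 1) * (fact n :: rat)" using C0 by simp
  then have "(0::rat) < of_nat M" using M by linarith
  then have M0: "M > 0" by simp
  define \<delta> where "\<delta> = C / of_nat M"
  have "C + 1 \<le> (C + 1) * fact n" using C0 f1 by (simp add: mult_le_cancel_left1)
  then have \<delta>: "0 \<le> \<delta>" "\<delta> \<le> 1" using C0 M M0 by (auto simp: \<delta>_def field_simps)
  have \<delta>n: "fact n * \<delta> < 1"
  proof -
    have "C * fact n \<le> (C + 1) * fact n" by (intro mult_right_mono) auto
    then have "C * fact n < of_nat M" using M by (rule le_less_trans)
    then show ?thesis using M0 by (simp add: \<delta>_def field_simps)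
  qed
  have "\<bar>nrm x\<bar> < 1" if x: "x \<in> K" "\<And>i. i < n \<Longrightarrow> \<bar>co x i\<bar> \<le> 1 / of_nat M" for x
  proof -
    have entry: "\<bar>co (x * b j) i\<bar> \<le> \<delta>" if "i < n" "j < n" for i j
    proof -
      have "co (x * b j) i = (\<Sum>k<n. co x k * co (b k * b j) i)"
        using co_mult[OF b_in[OF \<open>j < n\<close>] x(1) \<open>i < n\<close>] by (simp add: mult.commute)
      also have "\<bar>\<dots>\<bar> \<le> (\<Sum>k<n. \<bar>co x k * co (b k * b j) i\<bar>)" by (rule sum_abs)
      also have "\<dots> \<le> (\<Sum>k<n. 1 / of_nat M * \<bar>co (b k * b j) i\<bar>)"
        unfolding abs_mult using x(2) by (intro sum_mono mult_right_mono) auto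
      also have "\<dots> = (\<Sum>k<n. \<bar>co (b k * b j) i\<bar>) / of_nat M" by (simp add: sum_divide_distrib)
      also have "\<dots> \<le> \<delta>" unfolding \<delta>_def using C that by (intro divide_right_mono) auto
      finally show ?thesis .
    qed
    have "\<bar>nrm x\<bar> \<le> (\<Sum>p | p permutes {0..<n}. \<bar>signof p * (\<Prod>i = 0..<n. co (x * b (p i)) i)\<bar>)"
      unfolding nrm_sum by (rule sum_abs)
    also have "\<dots> \<le> (\<Sum>p | p permutes {0..<n}. \<delta>)"
    proof (rule sum_mono)
      fix p assume p: "p \<in> {p. p permutes {0..<n}}"
      have "\<bar>signof p * (\<Prod>i = 0..<n. co (x * b (p i)) i)\<bar> = (\<Prod>i = 0..<n. \<bar>co (x * b (p i)) i\<bar>)"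
        by (simp add: abs_mult abs_prod sign_def)
      also have "\<dots> \<le> (\<Prod>i = 0..<n. \<delta>)"
      proof (rule prod_mono)
        fix i assume i: "i \<in> {0..<n}"
        then have "p i < n" using permutes_in_image[of p "{0..<n}" i] p by auto
        then show "0 \<le> \<bar>co (x * b (p i)) i\<bar> \<and> \<bar>co (x * b (p i)) i\<bar> \<le> \<delta>" using entry i by auto
      qed
      also have "\<dots> = \<delta> ^ n" by simp
      also have "\<dots> \<le> \<delta> ^ 1" using \<delta> n_pos by (intro power_decreasing) auto
      finally show "\<bar>signof p * (\<Prod>i = 0..<n. co (x * b (p i)) i)\<bar> \<le> \<delta>" by simp
    qed
    also have "\<dots> = fact n * \<delta>" using card_permutations[of "{0..<n}" n] by simp
    finally show ?thesis using \<delta>n by simp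
  qed
  then show ?thesis using that M0 by blast
qed

text \<open>Hurwitz: a pigeonhole argument on the fractional parts of the coordinates of multiples.\<close>

lemma bounded_multiple_near_lattice:
  obtains T :: nat where
    "\<And>x. x \<in> K \<Longrightarrow> \<exists>t\<in>{1..T}. \<exists>\<omega>\<in>int_lattice. \<bar>nrm (of_nat t * x - \<omega>)\<bar> < 1"
proof -
  obtain M where M: "M > 0" "\<And>x. x \<in> K \<Longrightarrow> (\<And>i. i < n \<Longrightarrow> \<bar>co x i\<bar> \<le> 1 / of_nat M) \<Longrightarrow> \<bar>nrm x\<bar> < 1"
    using nrm_small by blast
  have "\<exists>t\<in>{1..M ^ n}. \<exists>\<omega>\<in>int_lattice. \<bar>nrm (of_nat t * x - \<omega>)\<bar> < 1" if x: "x \<in> K" for x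
  proof -
    \<comment> \<open>The unit cube of fractional parts is cut into M^n boxes of side 1/M, so two of
      the M^n + 1 multiples with t = 0, ..., M^n share a box; their difference t - s lies between 1
      and M^n.\<close>
    define f where "f t = restrict (\<lambda>i. nat \<lfloor>of_nat M * frac (of_nat t * co x i)\<rfloor>) {..<n}" for t :: nat
    have "nat \<lfloor>of_nat M * frac (of_nat t * co x i)\<rfloor> < M" for t :: nat and i
    proof -
      have "of_nat M * frac (of_nat t * co x i) < of_nat M * 1"
        using M frac_lt_1 by (intro mult_strict_left_mono) auto
      then have "\<lfloor>of_nat M * frac (of_nat t * co x i)\<rfloor> < int M" by (simp add: floor_less_iff)
      then show ?thesis using M by linarith
    qed
    then have sub: "f ` {0..M ^ n} \<subseteq> (\<Pi>\<^sub>E i\<in>{..<n}. {..<M})"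
      by (auto simp: f_def split: if_splits)
    have card: "card (\<Pi>\<^sub>E i\<in>{..<n}. {..<M}) = M ^ n" by (simp add: card_PiE)
    have fin: "finite (\<Pi>\<^sub>E i\<in>{..<n}. {..<M})" by (intro finite_PiE) auto
    have "card (f ` {0..M ^ n}) < card {0..M ^ n}"
      using card_mono[OF fin sub] card by simp
    then have "\<not> inj_on f {0..M ^ n}" by (rule pigeonhole)
    then obtain t s where ts: "t \<le> M ^ n" "s < t" "f s = f t"
      unfolding inj_on_def by (metis atLeastAtMost_iff linorder_neqE_nat)
    define a where "a i = \<lfloor>of_nat t * co x i\<rfloor> - \<lfloor>of_nat s * co x i\<rfloor>" for i
    define \<omega> where "\<omega> = (\<Sum>j<n. of_rat (of_int (a j)) * b j)"
    have \<omega>K: "\<omega> \<in> K" unfolding \<omega>_def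
      by (intro sf_sum[OF sK] sf_mult[OF sK] sf_of_rat[OF sK] b_in) auto
    have co_\<omega>: "co \<omega> i = of_int (a i)" if "i < n" for i unfolding \<omega>_def by (rule co_unique[OF that])
    have "\<omega> \<in> int_lattice" using \<omega>K co_\<omega> by (auto simp: int_lattice_def)
    moreover have "\<bar>nrm (of_nat (t - s) * x - \<omega>)\<bar> < 1"
    proof (rule M(2))
      have tK: "of_nat (t - s) * x \<in> K" using x sf_mult[OF sK sf_of_nat[OF sK]] by blast
      then show "of_nat (t - s) * x - \<omega> \<in> K" using \<omega>K sf_diff[OF sK] by blast
      fix i assume i: "i < n"
      let ?u = "frac (of_nat t * co x i)" and ?v = "frac (of_nat s * co x i)"
      have "co (of_nat (t - s) * x - \<omega>) i = of_nat (t - s) * co x i - of_int (a i)"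
        using co_diff[OF tK \<omega>K i] co_\<omega>[OF i] co_scale_int[OF x i, of "int (t - s)"] by simp
      also have "\<dots> = ?u - ?v" using ts by (simp add: frac_def a_def of_nat_diff algebra_simps)
      finally have eq: "co (of_nat (t - s) * x - \<omega>) i = ?u - ?v" .
      have "nat \<lfloor>of_nat M * ?u\<rfloor> = nat \<lfloor>of_nat M * ?v\<rfloor>"
        using fun_cong[OF ts(3), of i] i by (simp add: f_def)
      moreover have "\<lfloor>of_nat M * ?u\<rfloor> \<ge> 0" "\<lfloor>of_nat M * ?v\<rfloor> \<ge> 0" by (simp_all add: frac_ge_0)
      ultimately have "\<lfloor>of_nat M * ?u\<rfloor> = \<lfloor>of_nat M * ?v\<rfloor>" by linarith
      then have "\<bar>of_nat M * ?u - of_nat M * ?v\<bar> < 1" by linarith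
      then have "of_nat M * \<bar>?u - ?v\<bar> < 1" by (simp add: abs_mult flip: right_diff_distrib)
      then show "\<bar>co (of_nat (t - s) * x - \<omega>) i\<bar> \<le> 1 / of_nat M"
        using M unfolding eq by (simp add: field_simps)
    qed
    ultimately show ?thesis using ts by (intro bexI[of _ "t - s"] bexI[of _ \<omega>]) auto
  qed
  then show ?thesis by (rule that)
qed

end

section \<open>An element supported at a single place\<close>

text \<open>The integers are integrally closed, here in almost-integral form: if r has reduced
  denominator d, then d^k divides D for all k.\<close>

lemma int_power_bounded_imp_Ints:
  fixes r :: rat
  assumes "D \<noteq> 0" and "\<And>k. D * r ^ k \<in> \<int>"
  shows "r \<in> \<int>"
proof -
  obtain c d where cd: "r = Rat.Fract c d" "d > 0" "coprime c d" by (cases r)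
  have D: "of_int \<lfloor>D\<rfloor> = D" using assms(2)[of 0] by (simp add: Ints_rat_of_int)
  have dvd: "d ^ k dvd \<lfloor>D\<rfloor>" for k
  proof -
    obtain m where m: "D * r ^ k = of_int m" using assms(2)[of k] by (auto elim: Ints_cases)
    have "of_int \<lfloor>D\<rfloor> * (of_int c / of_int d) ^ k = (of_int m :: rat)"
      using m cd unfolding D by (simp add: Fract_of_int_quotient)
    then have "of_int (\<lfloor>D\<rfloor> * c ^ k) = (of_int (m * d ^ k) :: rat)"
      using cd by (simp add: power_divide field_simps)
    then have "\<lfloor>D\<rfloor> * c ^ k = m * d ^ k" by (simp only: of_int_eq_iff)
    then have "d ^ k dvd \<lfloor>D\<rfloor> * c ^ k" by simp
    moreover have "coprime (d ^ k) (c ^ k)" using cd by (simp add: coprime_commute)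
    ultimately show ?thesis by (simp add: coprime_dvd_mult_left_iff)
  qed
  have "d = 1"
  proof (rule ccontr)
    assume "d \<noteq> 1"
    then have "d \<ge> 2" using cd by simp
    \<comment> \<open>The exponent |D| suffices because k < 2^k.\<close>
    let ?k = "nat \<bar>\<lfloor>D\<rfloor>\<bar>"
    have "\<lfloor>D\<rfloor> \<noteq> 0" using D assms by auto
    then have "d ^ ?k \<le> \<bar>\<lfloor>D\<rfloor>\<bar>" using dvd[of ?k] by (simp add: zdvd_imp_le)
    moreover have "(2::int) ^ ?k \<le> d ^ ?k" using \<open>d \<ge> 2\<close> by (intro power_mono) auto
    moreover have "int ?k < 2 ^ ?k" using of_nat_less_two_power by blast
    ultimately show False by simp
  qed
  then show ?thesis using cd by (simp add: Fract_of_int_quotient)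
qed

context place
begin

lemma le_1_of_power_bounded:
  assumes "C > 0" "\<And>k. v x ^ k \<le> C"
  shows "v x \<le> 1"
proof (rule ccontr)
  assume "\<not> v x \<le> 1"
  then obtain k where "C < v x ^ k" using real_arch_pow[of "v x" C] by auto
  then show False using assms(2)[of k] by simp
qed

end

context lattice_basis
begin

text \<open>The maximal order, as the set of elements with a common denominator for all powers; this
description needs neither minimal polynomials nor a basis of the maximal order.\<close>

definition integers :: "complex set" where
  "integers = {x \<in> K. \<exists>D::int. D > 0 \<and> (\<forall>k. of_int D * x ^ k \<in> int_lattice)}"

lemma integers_in: "x \<in> integers \<Longrightarrow> x \<in> K" by (simp add: integers_def)

lemma integers_mult:
  assumes "x \<in> integers" "y \<in> integers"
  shows "x * y \<in> integers"
proof -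
  obtain D E :: int where D: "D > 0" "\<forall>k. of_int D * x ^ k \<in> int_lattice"
    and E: "E > 0" "\<forall>k. of_int E * y ^ k \<in> int_lattice"
    using assms by (auto simp: integers_def)
  have "of_int (D * E) * (x * y) ^ k \<in> int_lattice" for k
    using lattice_mult[of "of_int D * x ^ k" "of_int E * y ^ k"] D E
    by (simp add: power_mult_distrib mult_ac)
  then show ?thesis using assms D E sf_mult[OF sK]
    by (auto simp: integers_def intro!: exI[of _ "D * E"])
qed

lemma integers_diff:
  assumes "x \<in> integers" "y \<in> integers"
  shows "x - y \<in> integers"
proof -
  obtain D E :: int where D: "D > 0" "\<forall>k. of_int D * x ^ k \<in> int_lattice"
    and E: "E > 0" "\<forall>k. of_int E * y ^ k \<in> int_lattice"
    using assms by (auto simp: integers_def)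
  have "of_int (D * E) * (x - y) ^ k \<in> int_lattice" for k
  proof -
    have "(x + (- y)) ^ k = (\<Sum>i\<le>k. of_nat (k choose i) * x ^ i * (- y) ^ (k - i))"
      by (rule binomial_ring)
    then have "of_int (D * E) * (x - y) ^ k =
        of_int (D * E) * (\<Sum>i\<le>k. of_nat (k choose i) * x ^ i * (- y) ^ (k - i))" by simp
    also have "\<dots> = (\<Sum>i\<le>k. of_int (int (k choose i) * (- 1) ^ (k - i)) *
        ((of_int D * x ^ i) * (of_int E * y ^ (k - i))))"
      unfolding sum_distrib_left
      by (intro sum.cong refl) (simp add: power_minus[of y] mult_ac)
    also have "\<dots> \<in> int_lattice"
      using D E by (intro lattice_sum lattice_scale[OF lattice_mult]) auto
    finally show ?thesis .
  qed
  then show ?thesis using assms D E sf_diff[OF sK]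
    by (auto simp: integers_def intro!: exI[of _ "D * E"])
qed

lemma lattice_integers:
  assumes "x \<in> int_lattice"
  shows "x \<in> integers"
proof -
  obtain D :: int where D: "D > 0" "of_int D * 1 \<in> int_lattice"
    using lattice_multiple[OF sf_1[OF sK]] by blast
  \<comment> \<open>The case k = 0 is why D has to carry 1 into the lattice.\<close>
  have "of_int D * x ^ k \<in> int_lattice" for k
    using D assms by (cases "k = 0") (auto intro: lattice_scale lattice_power)
  then show ?thesis using D assms by (auto simp: integers_def lattice_in)
qed

lemma of_int_integers: "of_int m \<in> integers"
proof -
  obtain D :: int where D: "D > 0" "of_int D * 1 \<in> int_lattice"
    using lattice_multiple[OF sf_1[OF sK]] by blast
  have "of_int D * of_int m ^ k \<in> int_lattice" for k
    using lattice_scale[OF D(2), of "m ^ k"] by (simp add: mult.commute)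
  then show ?thesis using D by (auto simp: integers_def sf_of_int[OF sK])
qed

lemma integers_power: "x \<in> integers \<Longrightarrow> x ^ k \<in> integers"
  using of_int_integers[of 1] by (induction k) (auto simp: integers_mult)

text \<open>The norms of all D x^k are integers, so the norm of D is a common denominator for the
  powers of the norm of x.\<close>

lemma nrm_integers:
  assumes "x \<in> integers"
  shows "nrm x \<in> \<int>"
proof -
  obtain D :: int where D: "D > 0" "\<forall>k. of_int D * x ^ k \<in> int_lattice"
    using assms by (auto simp: integers_def)
  have x: "x \<in> K" using assms by (rule integers_in)
  have int: "nrm (of_int D) * nrm x ^ k \<in> \<int>" for k
    using nrm_lattice[OF D(2)[rule_format, of k]] x
    by (simp add: nrm_mult nrm_power sf_power[OF sK] sf_of_int[OF sK])
  have "nrm (of_int D) \<noteq> 0" using D by (intro nrm_nonzero sf_of_int[OF sK]) auto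
  then show ?thesis using int by (rule int_power_bounded_imp_Ints)
qed

text \<open>The values on the basis bound a place on the whole lattice, and the lattice is closed
  under positive powers; a value above 1 would outgrow the bound.\<close>

lemma place_lattice_le_1:
  assumes "place K p w" and x: "x \<in> int_lattice"
  shows "w x \<le> 1"
proof -
  interpret w: place K p w by fact
  define C where "C = 1 + (\<Sum>i<n. w (b i))"
  have C1: "C \<ge> 1" unfolding C_def using sum_nonneg[of "{..<n}" "\<lambda>i. w (b i)"] by simp
  have bound: "w y \<le> C" if y: "y \<in> int_lattice" for y
  proof -
    have "w (\<Sum>i<n. of_rat (co y i) * b i) \<le> C"
    proof (rule w.ultrametric_sum)
      fix i assume i: "i \<in> {..<n}"
      show "of_rat (co y i) * b i \<in> K" using i b_in sf_mult[OF sK sf_of_rat[OF sK]] by auto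
      obtain m where m: "co y i = of_int m" using y i by (auto simp: int_lattice_def elim: Ints_cases)
      have "w (of_rat (co y i) * b i) = w (of_int m) * w (b i)"
        using m i b_in sf_of_int[OF sK] by (simp add: w.mult)
      also have "\<dots> \<le> 1 * w (b i)" using w.of_int_le_1 by (intro mult_right_mono) auto
      also have "w (b i) \<le> (\<Sum>i<n. w (b i))" using i by (intro member_le_sum) auto
      finally show "w (of_rat (co y i) * b i) \<le> C" by (simp add: C_def)
    qed (use C1 in simp)
    then show ?thesis using y by (simp add: co_sum lattice_in)
  qed
  show ?thesis
  proof (rule w.le_1_of_power_bounded)
    show "C > 0" using C1 by simp
    show "w x ^ k \<le> C" for k
      using bound[OF lattice_power[OF _ x, of k]] x C1
      by (cases "k = 0") (auto simp: w.power lattice_in)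
  qed
qed

lemma place_integers_le_1:
  assumes "place K p w" and x: "x \<in> integers"
  shows "w x \<le> 1"
proof -
  interpret w: place K p w by fact
  obtain D :: int where D: "D > 0" "\<forall>k. of_int D * x ^ k \<in> int_lattice"
    using x by (auto simp: integers_def)
  have wD: "w (of_int D) > 0" using D by (intro w.pos sf_of_int[OF sK]) auto
  show ?thesis
  proof (rule w.le_1_of_power_bounded)
    show "1 / w (of_int D) > 0" using wD by simp
    show "w x ^ k \<le> 1 / w (of_int D)" for k
      using place_lattice_le_1[OF assms(1) D(2)[rule_format, of k]] wD integers_in[OF x]
      by (simp add: w.mult w.power sf_power[OF sK] sf_of_int[OF sK] field_simps)
  qed
qed

section \<open>Integers separating two places above the same prime\<close>

text \<open>The powers of z below N generate a module over the integers that contains 1 and is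
  stable under y, hence contains all powers of y; a common denominator of the generators serves them
  all.\<close>

lemma stable_span_integers:
  assumes y: "y \<in> K" and z: "z \<in> K" and N: "N > 0"
    and stable: "\<And>j. j < N \<Longrightarrow> \<exists>c::nat \<Rightarrow> int. y * z ^ j = (\<Sum>i<N. of_int (c i) * z ^ i)"
  shows "y \<in> integers"
proof -
  obtain d :: "nat \<Rightarrow> nat \<Rightarrow> int" where d: "\<And>j. j < N \<Longrightarrow> y * z ^ j = (\<Sum>i<N. of_int (d j i) * z ^ i)"
    using stable by metis
  have pow: "\<exists>c::nat \<Rightarrow> int. y ^ k = (\<Sum>i<N. of_int (c i) * z ^ i)" for k
  proof (induction k)
    case 0
    have "(\<Sum>i<N. of_int (if i = 0 then 1 else 0) * z ^ i) = (\<Sum>i<N. if i = 0 then 1 else 0)"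
      by (intro sum.cong) auto
    then show ?case using N by (intro exI[of _ "\<lambda>i. if i = 0 then 1 else 0"]) simp
  next
    case (Suc k)
    then obtain c :: "nat \<Rightarrow> int" where c: "y ^ k = (\<Sum>i<N. of_int (c i) * z ^ i)" by blast
    have "y ^ Suc k = (\<Sum>j<N. of_int (c j) * (y * z ^ j))"
      unfolding power_Suc c sum_distrib_left by (intro sum.cong) auto
    also have "\<dots> = (\<Sum>j<N. \<Sum>i<N. of_int (c j * d j i) * z ^ i)"
      unfolding sum_distrib_left by (intro sum.cong refl) (simp add: d sum_distrib_left mult_ac)
    also have "\<dots> = (\<Sum>i<N. \<Sum>j<N. of_int (c j * d j i) * z ^ i)" by (rule sum.swap)
    also have "\<dots> = (\<Sum>i<N. of_int (\<Sum>j<N. c j * d j i) * z ^ i)"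
      by (simp add: sum_distrib_right)
    finally show ?case by (intro exI[of _ "\<lambda>i. \<Sum>j<N. c j * d j i"])
  qed
  obtain D :: int where D: "D > 0" "\<forall>i\<in>{..<N}. of_int D * z ^ i \<in> int_lattice"
    using lattice_common_multiple[of "{..<N}" "\<lambda>i. z ^ i"] z sf_power[OF sK] by auto
  have "of_int D * y ^ k \<in> int_lattice" for k
  proof -
    obtain c :: "nat \<Rightarrow> int" where c: "y ^ k = (\<Sum>i<N. of_int (c i) * z ^ i)" using pow by blast
    have "of_int D * y ^ k = (\<Sum>i<N. of_int (c i) * (of_int D * z ^ i))"
      unfolding c sum_distrib_left by (intro sum.cong) auto
    also have "\<dots> \<in> int_lattice"
      using D by (intro lattice_sum) (rule lattice_scale, simp)
    finally show ?thesis .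
  qed
  then show ?thesis using y D by (auto simp: integers_def)
qed

text \<open>The bounds keep the exponents below N and the subtraction untruncated; terms with equal
  exponent are then collected.\<close>

lemma shifted_sum:
  fixes a :: "nat \<Rightarrow> int"
  assumes "\<And>i. i \<in> I \<Longrightarrow> i + j < N + m \<and> m \<le> i + j" "finite I"
  shows "\<exists>c::nat \<Rightarrow> int. (\<Sum>i\<in>I. of_int (a i) * z ^ (i + j - m)) = (\<Sum>i<N. of_int (c i) * (z::complex) ^ i)"
proof -
  have "(\<Sum>i\<in>I. of_int (a i) * z ^ (i + j - m)) =
        (\<Sum>l<N. \<Sum>i\<in>{i \<in> I. i + j - m = l}. of_int (a i) * z ^ (i + j - m))"
    using assms by (intro sum.group[symmetric]) force+
  also have "\<dots> = (\<Sum>l<N. of_int (\<Sum>i\<in>{i \<in> I. i + j - m = l}. a i) * z ^ l)"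
    by (intro sum.cong refl) (simp add: sum_distrib_right)
  finally show ?thesis by (intro exI[of _ "\<lambda>l. \<Sum>i\<in>{i \<in> I. i + j - m = l}. a i"])
qed

text \<open>The tail y = a_m + a_(m+1) z + ... stabilises the module generated by 1, ..., z^(N-1):
  for j < m the degree of y z^j stays below N, and for j \<ge> m the relation trades y z^m for minus
  the terms below m. The extreme tails vanish.\<close>

lemma horner_integers:
  fixes a :: "nat \<Rightarrow> int"
  assumes z: "z \<in> K" and a: "(\<Sum>i\<le>N. of_int (a i) * z ^ i) = 0" and m: "m \<le> Suc N"
  shows "(\<Sum>i=m..N. of_int (a i) * z ^ (i - m)) \<in> integers"
proof (cases "m = 0 \<or> m = Suc N")
  case True
  then have "(\<Sum>i=m..N. of_int (a i) * z ^ (i - m)) = 0" using a by (auto simp: atMost_atLeast0)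
  then show ?thesis using of_int_integers[of 0] by simp
next
  case False
  then have m: "0 < m" "m \<le> N" using m by auto
  let ?y = "\<Sum>i=m..N. of_int (a i) * z ^ (i - m)"
  show ?thesis
  proof (rule stable_span_integers[OF _ z])
    show "?y \<in> K" by (intro sf_sum[OF sK] sf_mult[OF sK] sf_of_int[OF sK] sf_power[OF sK] z)
    show "N > 0" using m by simp
    fix j assume j: "j < N"
    show "\<exists>c::nat \<Rightarrow> int. ?y * z ^ j = (\<Sum>i<N. of_int (c i) * z ^ i)"
    proof (cases "j < m")
      case True
      have "?y * z ^ j = (\<Sum>i=m..N. of_int (a i) * z ^ (i + j - m))"
        unfolding sum_distrib_right by (intro sum.cong refl) (auto simp flip: power_add)
      then show ?thesis using shifted_sum[of "{m..N}" j N m a z] True by auto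
    next
      case False
      have "(\<Sum>i\<le>N. of_int (a i) * z ^ i) = (\<Sum>i<m. of_int (a i) * z ^ i) + (\<Sum>i=m..N. of_int (a i) * z ^ i)"
        using m by (subst sum.union_disjoint[symmetric]) (auto intro!: sum.cong)
      moreover have "(\<Sum>i=m..N. of_int (a i) * z ^ i) = ?y * z ^ m"
        unfolding sum_distrib_right by (intro sum.cong refl) (auto simp flip: power_add)
      ultimately have "?y * z ^ m = (\<Sum>i<m. of_int (- a i) * z ^ i)"
        using a by (simp add: sum_negf eq_neg_iff_add_eq_0 add.commute)
      then have "?y * z ^ m * z ^ (j - m) = (\<Sum>i<m. of_int (- a i) * z ^ (i + j - m))"
        using False by (simp add: sum_distrib_right mult.assoc flip: power_add)
      moreover have "?y * z ^ m * z ^ (j - m) = ?y * z ^ j"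
        using False by (simp add: mult.assoc flip: power_add)
      ultimately show ?thesis using shifted_sum[of "{..<m}" j N m "\<lambda>i. - a i" z] False j m by auto
    qed
  qed
qed

text \<open>The separating z need not be integral, but for the Horner tails y_m both y_m and z
  y_(m+1) = y_m - a_m are. Since w z > 1, integrality of z y_m makes every y_m small at w, so z
  y_(i+1) has value 1 at w when p does not divide a_i; at v it is small because z is.\<close>

lemma separating_integer:
  assumes "place K p v" "place K p w" "v \<noteq> w"
  shows "\<exists>u\<in>integers. v u < 1 \<and> w u = 1"
proof -
  interpret v: place K p v by fact
  interpret w: place K p w by fact
  obtain z where z: "z \<in> K" "v z < 1" "1 < w z" using separating_element[OF assms] by blast
  obtain N and a :: "nat \<Rightarrow> int" where a: "(\<Sum>i\<le>N. of_int (a i) * z ^ i) = 0" "\<exists>i\<le>N. \<not> int p dvd a i"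
    using number_field_primitive_relation[OF nf] z(1) v.prime by meson
  define y where "y m = (\<Sum>i=m..N. of_int (a i) * z ^ (i - m))" for m
  have y_int: "y m \<in> integers" if "m \<le> Suc N" for m
    unfolding y_def by (rule horner_integers[OF z(1) a(1) that])
  have rec: "y m = of_int (a m) + z * y (Suc m)" if "m \<le> N" for m
  proof -
    have "y m = of_int (a m) + (\<Sum>i=Suc m..N. of_int (a i) * z ^ (i - m))"
      using that by (simp add: y_def sum.atLeast_Suc_atMost)
    also have "(\<Sum>i=Suc m..N. of_int (a i) * z ^ (i - m)) = z * y (Suc m)"
      unfolding y_def sum_distrib_left
    proof (intro sum.cong refl)
      fix i assume "i \<in> {Suc m..N}"
      then have "i - m = Suc (i - Suc m)" by auto
      then show "of_int (a i) * z ^ (i - m) = z * (of_int (a i) * z ^ (i - Suc m))" by simp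
    qed
    finally show ?thesis .
  qed
  have zy: "z * y (Suc m) \<in> integers" if "m \<le> N" for m
    using integers_diff[OF y_int[of m] of_int_integers[of "a m"]] rec[OF that] that by simp
  have y_less: "w (y m) < 1" if "m \<le> Suc N" for m
  proof (cases m)
    case 0
    then show ?thesis using a(1) by (simp add: y_def atMost_atLeast0)
  next
    case (Suc k)
    have le: "w z * w (y m) \<le> 1"
      using place_integers_le_1[OF assms(2) zy[of k]] Suc that z integers_in[OF y_int[OF that]]
      by (simp add: w.mult)
    show ?thesis
    proof (rule ccontr)
      assume "\<not> w (y m) < 1"
      then have "w z * 1 \<le> w z * w (y m)" by (intro mult_left_mono) auto
      then show False using le z(3) by linarith
    qed
  qed
  obtain i where i: "i \<le> N" "\<not> int p dvd a i" using a(2) by blast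
  let ?u = "z * y (Suc i)"
  have "w ?u = 1"
  proof (rule ccontr)
    assume "w ?u \<noteq> 1"
    then have less: "w ?u < 1" using place_integers_le_1[OF assms(2) zy[OF i(1)]] by simp
    have "w (y i - ?u) \<le> max (w (y i)) (w ?u)"
      using y_int zy i integers_in by (intro w.ultrametric_diff) auto
    also have "\<dots> < 1" using less y_less i by simp
    finally show False using rec[OF i(1)] w.of_int_eq_1[OF i(2)] by simp
  qed
  moreover have "v ?u < 1"
  proof -
    have "v ?u = v z * v (y (Suc i))" using z integers_in[OF y_int] i by (simp add: v.mult)
    also have "\<dots> \<le> v z * 1"
      using place_integers_le_1[OF assms(1) y_int] i by (intro mult_left_mono) auto
    finally show ?thesis using z by simp
  qed
  ultimately show ?thesis using zy[OF i(1)] by blast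
qed

text \<open>For the ideals \<open>I m\<close> of integers divisible by \<open>p\<^sup>m\<close> at the single place \<open>v\<close>, an element of
least norm generates \<open>I m\<close> up to a bounded factor, so away from \<open>v\<close> its values take finitely many
values as \<open>m\<close> varies, and a quotient of two of these elements has trivial value there.\<close>

lemma single_place_element:
  assumes v: "place K p v" and S: "\<forall>q\<in>S. prime q"
  shows "\<exists>\<alpha>\<in>K. \<alpha> \<noteq> 0 \<and> v \<alpha> \<noteq> 1 \<and> (\<forall>w\<in>places_S S K. w \<noteq> v \<longrightarrow> w \<alpha> = 1)"
proof -
  interpret v: place K p v by fact
  define I where "I m = {x \<in> integers. v x \<le> (1 / real p) ^ m}" for m :: nat
  obtain T :: nat where T: "\<And>x. x \<in> K \<Longrightarrow> \<exists>t\<in>{1..T}. \<exists>\<omega>\<in>int_lattice. \<bar>nrm (of_nat t * x - \<omega>)\<bar> < 1"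
    using bounded_multiple_near_lattice by blast
  \<comment> \<open>T! is a multiple of every t in 1, ..., T, so one factor serves all
    \<gamma>.\<close>
  define B :: nat where "B = fact T"
  have B0: "B \<noteq> 0" by (simp add: B_def)
  have "\<exists>\<beta>. \<beta> \<in> I m \<and> \<beta> \<noteq> 0 \<and> (\<forall>\<gamma>\<in>I m. \<exists>\<omega>\<in>integers. of_nat B * \<gamma> = \<beta> * \<omega>)" for m
  proof -
    have "of_nat p ^ m \<in> I m \<and> of_nat p ^ m \<noteq> (0::complex)"
      using integers_power[OF of_int_integers[of "int p"]] v.p_gt_1
      by (auto simp: I_def v.power v.p_in v.of_nat_p)
    \<comment> \<open>Norms on \<open>I m\<close> are integers, so rounding to a natural number
      loses nothing and a least one exists.\<close>
    then obtain \<beta> where \<beta>: "\<beta> \<in> I m" "\<beta> \<noteq> 0"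
      and least: "\<And>x. x \<in> I m \<Longrightarrow> x \<noteq> 0 \<Longrightarrow> nat \<lfloor>\<bar>nrm \<beta>\<bar>\<rfloor> \<le> nat \<lfloor>\<bar>nrm x\<bar>\<rfloor>"
      using ex_has_least_nat[of "\<lambda>x. x \<in> I m \<and> x \<noteq> 0" _ "\<lambda>x. nat \<lfloor>\<bar>nrm x\<bar>\<rfloor>"] by blast
    have \<beta>K: "\<beta> \<in> K" using \<beta> by (simp add: I_def integers_in)
    have minimal: "\<bar>nrm \<beta>\<bar> \<le> \<bar>nrm x\<bar>" if "x \<in> I m" "x \<noteq> 0" for x
    proof -
      have "\<bar>nrm y\<bar> = of_nat (nat \<lfloor>\<bar>nrm y\<bar>\<rfloor>)" if "y \<in> I m" for y
      proof -
        have "\<bar>nrm y\<bar> \<in> \<int>" using nrm_integers[of y] that by (auto simp: I_def)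
        then show ?thesis by (auto elim!: Ints_cases)
      qed
      then show ?thesis using least[OF that] \<beta>(1) that(1) by (metis of_nat_le_iff)
    qed
    have "\<exists>\<omega>\<in>integers. of_nat B * \<gamma> = \<beta> * \<omega>" if \<gamma>: "\<gamma> \<in> I m" for \<gamma>
    proof -
      have \<gamma>K: "\<gamma> \<in> K" using \<gamma> by (simp add: I_def integers_in)
      obtain t \<omega> where t: "t \<in> {1..T}" "\<omega> \<in> int_lattice" "\<bar>nrm (of_nat t * (\<gamma> / \<beta>) - \<omega>)\<bar> < 1"
        using T[OF sf_divide[OF sK \<gamma>K \<beta>K]] by blast
      have \<omega>: "\<omega> \<in> integers" using t lattice_integers by blast
      \<comment> \<open>This remainder of t \<gamma> on division by \<beta> lies in
        \<open>I m\<close> and has norm below that of \<beta>, so it vanishes.\<close>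
      let ?\<delta> = "of_nat t * \<gamma> - \<omega> * \<beta>"
      have "?\<delta> = (of_nat t * (\<gamma> / \<beta>) - \<omega>) * \<beta>" using \<beta> by (simp add: field_simps)
      then have "nrm ?\<delta> = nrm (of_nat t * (\<gamma> / \<beta>) - \<omega>) * nrm \<beta>"
        using \<beta>K \<gamma>K integers_in[OF \<omega>]
        by (simp only:) (intro nrm_mult sf_diff[OF sK] sf_mult[OF sK] sf_divide[OF sK] sf_of_nat[OF sK])
      then have "\<bar>nrm ?\<delta>\<bar> < 1 * \<bar>nrm \<beta>\<bar>"
        using t(3) nrm_nonzero[OF \<beta>K \<beta>(2)] unfolding abs_mult by (simp add: abs_mult)
      moreover have "?\<delta> \<in> I m"
      proof -
        have le: "v x * v y \<le> 1 * (1 / real p) ^ m" if "v x \<le> 1" "y \<in> I m" for x y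
          using that by (intro mult_mono) (auto simp: I_def)
        have "v (of_nat t * \<gamma>) \<le> 1 * (1 / real p) ^ m"
          using le[OF v.of_nat_le_1 \<gamma>] \<gamma>K sf_of_nat[OF sK] by (simp add: v.mult)
        moreover have "v (\<omega> * \<beta>) \<le> 1 * (1 / real p) ^ m"
          using le[OF place_integers_le_1[OF v \<omega>] \<beta>(1)] \<beta>K integers_in[OF \<omega>] by (simp add: v.mult)
        ultimately have "v ?\<delta> \<le> (1 / real p) ^ m"
          using \<beta>K \<gamma>K integers_in[OF \<omega>] sf_of_nat[OF sK]
          by (intro v.ultrametric_diff sf_mult[OF sK]) auto
        moreover have "?\<delta> \<in> integers"
          using \<gamma> \<beta> \<omega> of_int_integers[of "int t"] by (auto simp: I_def intro!: integers_diff integers_mult)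
        ultimately show ?thesis by (simp add: I_def)
      qed
      ultimately have "?\<delta> = 0" using minimal by force
      then have eq: "of_nat t * \<gamma> = \<beta> * \<omega>" by (simp add: mult.commute)
      have "t dvd B" using t(1) by (auto simp: B_def intro!: dvd_fact)
      then obtain s where s: "B = t * s" by (rule dvdE)
      have "of_nat B * \<gamma> = of_nat s * (of_nat t * \<gamma>)" by (simp add: s mult_ac)
      then have "of_nat B * \<gamma> = \<beta> * (of_int (int s) * \<omega>)" by (simp add: eq mult.left_commute)
      then show ?thesis using integers_mult[OF of_int_integers \<omega>] by blast
    qed
    then show ?thesis using \<beta> by blast
  qed
  then obtain \<beta> where \<beta>: "\<And>m. \<beta> m \<in> I m" "\<And>m. \<beta> m \<noteq> 0"
    and gen: "\<And>m \<gamma>. \<gamma> \<in> I m \<Longrightarrow> \<exists>\<omega>\<in>integers. of_nat B * \<gamma> = \<beta> m * \<omega>"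
    by metis
  have \<beta>_int: "\<beta> m \<in> integers" for m using \<beta>(1)[of m] by (simp add: I_def)
  have \<beta>K: "\<beta> m \<in> K" for m using \<beta>_int integers_in by blast
  obtain N where N: "\<And>x. x \<in> K \<Longrightarrow> \<exists>a::nat \<Rightarrow> int. (\<Sum>i\<le>N. of_int (a i) * x ^ i) = 0 \<and> (\<exists>i\<le>N. a i \<noteq> 0)"
    using number_field_primitive_relation[OF nf] by blast
  have place: "\<exists>q\<in>S. place K q w" if "w \<in> places_S S K" for w
    using that S nf unfolding places_S_def by (blast intro: place_I)
  \<comment> \<open>An integer u small at v and of value 1 at w has a power in \<open>I m\<close>,
    so \<beta> m divides B u^k among the integers; at w this bounds \<beta> m from below by
    B.\<close>
  have bounds: "w (of_nat B) \<le> w (\<beta> m) \<and> w (\<beta> m) \<le> 1" if w: "place K q w" "w \<noteq> v" for w q m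
  proof
    interpret w: place K q w by fact
    show "w (\<beta> m) \<le> 1" using place_integers_le_1[OF w(1) \<beta>_int] .
    obtain u where u: "u \<in> integers" "v u < 1" "w u = 1"
    proof (cases "q = p")
      case True
      then show ?thesis using separating_integer[OF v, of w] w that by auto
    next
      \<comment> \<open>Above a different prime, p itself serves as u.\<close>
      case False
      then have "\<not> int q dvd int p" using v.prime w.prime primes_dvd_imp_eq by (simp, blast)
      then show ?thesis
        using that[of "of_nat p"] of_int_integers[of "int p"] w.of_int_eq_1[of "int p"] v.p_gt_1
        by (simp add: v.of_nat_p)
    qed
    obtain k where k: "v u ^ k < (1 / real p) ^ m"
      using real_arch_pow_inv[of "(1 / real p) ^ m" "v u"] u v.p_gt_1 by auto
    have uK: "u \<in> K" using u integers_in by blast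
    have "u ^ k \<in> I m" using k u uK integers_power by (simp add: I_def v.power)
    then obtain \<omega> where \<omega>: "\<omega> \<in> integers" "of_nat B * u ^ k = \<beta> m * \<omega>" using gen by blast
    have "w (of_nat B) = w (of_nat B * u ^ k)"
      using u uK by (simp add: w.mult w.power sf_of_nat[OF sK] sf_power[OF sK])
    also have "\<dots> = w (\<beta> m) * w \<omega>" using \<omega> \<beta>K integers_in by (simp add: w.mult)
    also have "\<dots> \<le> w (\<beta> m) * 1" using place_integers_le_1[OF w(1) \<omega>(1)] by (intro mult_left_mono) auto
    finally show "w (of_nat B) \<le> w (\<beta> m)" by simp
  qed
  \<comment> \<open>At the places other than v outside W the bounds force the value of \<beta> m to
    be 1. Places in W lie above primes dividing B, so W is finite.\<close>
  define W where "W = {w \<in> places_S S K. w \<noteq> v \<and> w (of_nat B) \<noteq> 1}"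
  have fin_W: "finite W"
  proof (rule finite_subset)
    show "W \<subseteq> (\<Union>q\<in>prime_factors B. {w. place_over K q w})"
    proof
      fix w assume w: "w \<in> W"
      then obtain q where q: "q \<in> S" "place_over K q w" by (auto simp: W_def places_S_def)
      interpret w: place K q w using q S nf place_I by auto
      have "q dvd B" using w w.of_int_eq_1[of "int B"] by (auto simp: W_def)
      then show "w \<in> (\<Union>q\<in>prime_factors B. {w. place_over K q w})"
        using q w.prime B0 by (auto simp: prime_factors_dvd)
    qed
    show "finite (\<Union>q\<in>prime_factors B. {w. place_over K q w})"
      using finite_places_over[OF nf] by (intro finite_UN_I) auto
  qed
  have fin_values: "finite (range (\<lambda>m. w (\<beta> m)))" if w: "w \<in> W" for w
  proof -
    obtain q where q: "place K q w" using w place by (auto simp: W_def)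
    interpret w: place K q w by fact
    define J where "J = multiplicity (int q) (int B)"
    have wB: "w (of_nat B) = real q powr (- real J)" using w.of_int[of "int B"] B0 by (simp add: J_def)
    \<comment> \<open>The exponents lie between -J and 0 and have denominator N!, which leaves
      finitely many.\<close>
    have "w (\<beta> m) \<in> (\<lambda>j. real q powr (real_of_int j / fact N)) ` {- int (J * fact N)..0}" for m
    proof -
      obtain j :: int where j: "w (\<beta> m) = real q powr (j / fact N)"
        using w.value_powr_fact[OF \<beta>K[of m] \<beta>(2)[of m], of N] N[OF \<beta>K[of m]] by blast
      have "real q powr (- real J) \<le> real q powr (j / fact N)" "real q powr (j / fact N) \<le> real q powr 0"
        using bounds[OF q, of m] w wB j w.p_gt_1 by (auto simp: W_def)
      then have *: "- real J \<le> j / fact N" "j / fact N \<le> 0"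
        using w.p_gt_1 by (simp_all only: powr_le_cancel_iff)
      have fN: "(fact N :: real) > 0" by simp
      have "- real J * fact N \<le> real_of_int j" "real_of_int j \<le> 0 * fact N"
        using * fN by (simp_all only: pos_le_divide_eq pos_divide_le_eq)
      then have "real_of_int (- int (J * fact N)) \<le> real_of_int j" "j \<le> 0" by simp_all
      then have "j \<in> {- int (J * fact N)..0}" by (simp only: of_int_le_iff) simp
      then show ?thesis using j by blast
    qed
    then have "range (\<lambda>m. w (\<beta> m)) \<subseteq> (\<lambda>j. real q powr (real_of_int j / fact N)) ` {- int (J * fact N)..0}"
      by blast
    then show ?thesis by (rule finite_subset) simp
  qed
  define f where "f m = restrict (\<lambda>w. w (\<beta> m)) W" for m
  have "range f \<subseteq> (\<Pi>\<^sub>E w\<in>W. range (\<lambda>m. w (\<beta> m)))" by (auto simp: f_def split: if_splits)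
  then have "finite (range f)"
    by (rule finite_subset) (rule finite_PiE[OF fin_W fin_values])
  \<comment> \<open>Infinitely many indices share the value pattern of m on W, and a large one among
    them makes the value at v drop below that of \<beta> m.\<close>
  then obtain m where m: "infinite {m'. f m' = f m}"
    using pigeonhole_infinite[of "UNIV :: nat set" f] by auto
  obtain k where k: "(1 / real p) ^ k < v (\<beta> m)"
    using real_arch_pow_inv[of "v (\<beta> m)" "1 / real p"] v.pos[OF \<beta>K \<beta>(2)] v.p_gt_1 by auto
  obtain m' where m': "m' > k" "f m' = f m" using m unfolding infinite_nat_iff_unbounded by auto
  have "v (\<beta> m') \<le> (1 / real p) ^ m'" using \<beta>(1)[of m'] by (simp add: I_def)
  also have "\<dots> \<le> (1 / real p) ^ k" using m' v.p_gt_1 by (intro power_decreasing) auto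
  finally have less: "v (\<beta> m') < v (\<beta> m)" using k by simp
  have eq: "w (\<beta> m') = w (\<beta> m)" if w: "w \<in> places_S S K" "w \<noteq> v" for w
  proof (cases "w \<in> W")
    case True
    then show ?thesis using fun_cong[OF m'(2), of w] by (simp add: f_def)
  next
    case False
    then have "w (of_nat B) = 1" using w by (simp add: W_def)
    then show ?thesis using bounds[of _ w m] bounds[of _ w m'] place[OF w(1)] w(2) by force
  qed
  show ?thesis
  proof (intro bexI conjI ballI impI)
    show "\<beta> m / \<beta> m' \<in> K" using \<beta>K sf_divide[OF sK] by blast
    show "\<beta> m / \<beta> m' \<noteq> 0" using \<beta>(2) by simp
    show "v (\<beta> m / \<beta> m') \<noteq> 1" using less \<beta>K by (auto simp: v.divide)
    show "w (\<beta> m / \<beta> m') = 1" if wS: "w \<in> places_S S K" "w \<noteq> v" for w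
    proof -
      obtain q where "place K q w" using place[OF wS(1)] by blast
      then interpret w: place K q w .
      show ?thesis using eq[OF wS] w.pos[OF \<beta>K \<beta>(2), of m] \<beta>K by (simp add: w.divide)
    qed
  qed
qed

text \<open>Suitable D and E carry \<alpha> and 1/\<alpha> into the lattice. Above a prime not
  dividing D E both then have value at most 1, so only the finitely many places above divisors of D
  E remain.\<close>

lemma finite_support:
  assumes S: "\<forall>q\<in>S. prime q" and \<alpha>: "\<alpha> \<in> K" "\<alpha> \<noteq> 0"
  shows "finite {w \<in> places_S S K. w \<alpha> \<noteq> 1}"
proof -
  obtain D :: int where D: "D > 0" "of_int D * \<alpha> \<in> int_lattice" using lattice_multiple \<alpha> by blast
  obtain E :: int where E: "E > 0" "of_int E * inverse \<alpha> \<in> int_lattice"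
    using lattice_multiple sf_inverse[OF sK \<alpha>(1)] by blast
  show ?thesis
  proof (rule finite_subset)
    show "{w \<in> places_S S K. w \<alpha> \<noteq> 1} \<subseteq> (\<Union>q\<in>prime_factors (nat (D * E)). {w. place_over K q w})"
    proof
      fix w assume w: "w \<in> {w \<in> places_S S K. w \<alpha> \<noteq> 1}"
      then obtain q where q: "q \<in> S" "place_over K q w" by (auto simp: places_S_def)
      then have pl: "place K q w" using S nf place_I by auto
      interpret w: place K q w by fact
      have "int q dvd D * E"
      proof (rule ccontr)
        assume "\<not> int q dvd D * E"
        then have "w (of_int D) = 1" "w (of_int E) = 1" by (auto intro!: w.of_int_eq_1)
        then have "w \<alpha> \<le> 1" "inverse (w \<alpha>) \<le> 1"
          using place_lattice_le_1[OF pl D(2)] place_lattice_le_1[OF pl E(2)] \<alpha>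
          by (auto simp: w.mult w.inverse sf_of_int[OF sK] sf_inverse[OF sK])
        then show False using w w.pos[OF \<alpha>] by (simp add: inverse_le_1_iff)
      qed
      moreover have "D * E > 0" using D E by simp
      ultimately show "w \<in> (\<Union>q\<in>prime_factors (nat (D * E)). {w. place_over K q w})"
        using q w.prime by (auto simp: prime_factors_dvd nat_dvd_iff int_dvd_int_iff[symmetric] simp del: int_dvd_int_iff)
    qed
    show "finite (\<Union>q\<in>prime_factors (nat (D * E)). {w. place_over K q w})"
      using finite_places_over[OF nf] by (intro finite_UN_I) auto
  qed
qed

end

section \<open>Rational values of the functional\<close>

lemma ln_value_rational:
  assumes K: "number_field K" and v: "place K p v" and x: "x \<in> K" "x \<noteq> 0"
  shows "\<exists>r::rat. ln (v x) = of_rat r * ln (real p)"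
proof -
  interpret v: place K p v by fact
  obtain N and a :: "nat \<Rightarrow> int" where "(\<Sum>i\<le>N. of_int (a i) * x ^ i) = 0" "\<exists>i\<le>N. a i \<noteq> 0"
    using number_field_primitive_relation[OF K] x(1) by meson
  then obtain j :: int where "v x = real p powr (j / fact N)" using v.value_powr_fact[OF x] by blast
  then have "ln (v x) = (of_int j / fact N) * ln (real p)" using v.p_gt_1 by (simp add: ln_powr)
  moreover have "(of_int j / fact N :: real) = of_rat (of_int j / fact N)"
    by (simp add: of_rat_divide of_rat_of_nat_eq[of "fact N", simplified])
  ultimately show ?thesis by metis
qed

lemma prime_below_eq:
  assumes "number_field K" "\<forall>p\<in>S. prime p" "p \<in> S" "place_over K p v"
  shows "prime_below S K v = p"
  unfolding prime_below_def
proof (rule the_equality)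
  show "p \<in> S \<and> place_over K p v" using assms by simp
  fix q assume "q \<in> S \<and> place_over K q v"
  then show "q = p"
    using same_prime[of K K q p v v] assms number_field_subfield by (auto simp: divides_place_def)
qed

lemma Phi_f_alpha_number_field:
  assumes "\<forall>p\<in>S. prime p" "consistent S c" and K: "number_field K" and \<alpha>: "\<alpha> \<in> K" "\<alpha> \<noteq> 0"
  shows "finite {v \<in> places_S S K. ln (v \<alpha>) \<noteq> 0}"
    and "Phi S c (f_alpha \<alpha>) = (\<Sum>v \<in> {v \<in> places_S S K. ln (v \<alpha>) \<noteq> 0}. c K v * ln (v \<alpha>))"
proof -
  obtain n b co where "lattice_basis K n b co" using lattice_basis_exists[OF K] by blast
  then interpret lattice_basis K n b co .
  have "{v \<in> places_S S K. ln (v \<alpha>) \<noteq> 0} \<subseteq> {v \<in> places_S S K. v \<alpha> \<noteq> 1}" by auto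
  then show fin: "finite {v \<in> places_S S K. ln (v \<alpha>) \<noteq> 0}"
    using finite_support[OF assms(1) \<alpha>] finite_subset by blast
  show "Phi S c (f_alpha \<alpha>) = (\<Sum>v \<in> {v \<in> places_S S K. ln (v \<alpha>) \<noteq> 0}. c K v * ln (v \<alpha>))"
    by (rule Phi_f_alpha[OF assms(1,2) K \<alpha>(1) fin])
qed

theorem theorem4p2:
  fixes S :: "nat set" and c :: "complex set \<Rightarrow> (complex \<Rightarrow> real) \<Rightarrow> real"
  assumes "\<forall>p\<in>S. prime p"
    and "consistent S c"
  shows "(\<forall>\<alpha>\<in>Qbar. \<alpha> \<noteq> 0 \<longrightarrow> Phi S c (f_alpha \<alpha>) \<in> \<rat>) \<longleftrightarrow>
         (\<forall>(K, v) \<in> J_set S. c K v * ln (real (prime_below S K v)) \<in> \<rat>)"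
proof
  assume Phi: "\<forall>\<alpha>\<in>Qbar. \<alpha> \<noteq> 0 \<longrightarrow> Phi S c (f_alpha \<alpha>) \<in> \<rat>"
  have "c K v * ln (real (prime_below S K v)) \<in> \<rat>" if K: "number_field K" and v: "v \<in> places_S S K" for K v
  proof -
    obtain p where p: "p \<in> S" "place_over K p v" using v by (auto simp: places_S_def)
    have pl: "place K p v" using place_I K p assms(1) by auto
    interpret v: place K p v by fact
    obtain n b co where "lattice_basis K n b co" using lattice_basis_exists[OF K] by blast
    then interpret lattice_basis K n b co .
    obtain \<alpha> where \<alpha>: "\<alpha> \<in> K" "\<alpha> \<noteq> 0" "v \<alpha> \<noteq> 1" "\<forall>w\<in>places_S S K. w \<noteq> v \<longrightarrow> w \<alpha> = 1"
      using single_place_element[OF pl assms(1)] by blast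
    have ln0: "ln (v \<alpha>) \<noteq> 0" using v.pos[OF \<alpha>(1,2)] \<alpha>(3) by simp
    then have "{w \<in> places_S S K. ln (w \<alpha>) \<noteq> 0} = {v}" using v \<alpha>(4) by auto
    then have "Phi S c (f_alpha \<alpha>) = c K v * ln (v \<alpha>)"
      using Phi_f_alpha_number_field(2)[OF assms K \<alpha>(1,2)] by simp
    then have rat: "c K v * ln (v \<alpha>) \<in> \<rat>"
      using Phi \<alpha>(1,2) number_field_subset_Qbar[OF K] by auto
    obtain r where r: "ln (v \<alpha>) = of_rat r * ln (real p)" using ln_value_rational[OF K pl \<alpha>(1,2)] by blast
    \<comment> \<open>The rational factor r is nonzero because ln (v \<alpha>) is, so it can be
      divided out of the single surviving term.\<close>
    then have "c K v * ln (real p) = (c K v * ln (v \<alpha>)) / of_rat r" using ln0 by (cases "r = 0") auto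
    then show ?thesis using rat prime_below_eq[OF K assms(1) p] by simp
  qed
  then show "\<forall>(K, v) \<in> J_set S. c K v * ln (real (prime_below S K v)) \<in> \<rat>" by (auto simp: J_set_def)
next
  assume c: "\<forall>(K, v) \<in> J_set S. c K v * ln (real (prime_below S K v)) \<in> \<rat>"
  show "\<forall>\<alpha>\<in>Qbar. \<alpha> \<noteq> 0 \<longrightarrow> Phi S c (f_alpha \<alpha>) \<in> \<rat>"
  proof (intro ballI impI)
    fix \<alpha> assume "\<alpha> \<in> Qbar" and \<alpha>0: "\<alpha> \<noteq> 0"
    then obtain K where K: "number_field K" "\<alpha> \<in> K" by (auto simp: Qbar_def)
    have "c K v * ln (v \<alpha>) \<in> \<rat>" if v: "v \<in> places_S S K" for v
    proof -
      obtain p where p: "p \<in> S" "place_over K p v" using v by (auto simp: places_S_def)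
      obtain r where r: "ln (v \<alpha>) = of_rat r * ln (real p)"
        using ln_value_rational[OF K(1) place_I[OF K(1) _ p(2)] K(2) \<alpha>0] assms(1) p(1) by auto
      have "c K v * ln (real p) \<in> \<rat>"
        using c K(1) v prime_below_eq[OF K(1) assms(1) p] by (auto simp: J_set_def)
      then have "of_rat r * (c K v * ln (real p)) \<in> \<rat>" by (rule Rats_mult[OF Rats_of_rat])
      then show ?thesis by (simp add: r mult_ac)
    qed
    then show "Phi S c (f_alpha \<alpha>) \<in> \<rat>"
      unfolding Phi_f_alpha_number_field(2)[OF assms K \<alpha>0] by (intro Rats_sum) auto
  qed
qed

end
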